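(* Let $1<q\le p\le\infty$ and let $\phi\in\mathcal{G}_{q,p}$. Assume that there is a constant $C>0$ such that for any $r>0$, $$\int_{r}^{\infty}\phi^{q}(t)\,t^{\frac{dq}{p}-1}\,dt\le C\,\phi^{q}(r)\,r^{\frac{dq}{p}}.$$ Then there is a constant $C'>0$, not depending on $f$, such that $$\|Mf\|_{(L^{q},L^{p})^{\phi}(\mathbb{R}^{d})}\le C'\,\|f\|_{(L^{q},L^{p})^{\phi}(\mathbb{R}^{d})}\qquad\text{for all } f\in(L^{q},L^{p})^{\phi}(\mathbb{R}^{d}),$$ where $M$ is the Hardy-Littlewood maximal operator.
   Context: Convention: $\frac{1}{\infty}=0$. $L^{0}(\mathbb{R}^{d})$ is the space of (a.e.-equivalence classes of) Lebesgue measurable complex-valued functions on $\mathbb{R}^{d}$; $B(x,r)$ is the ball with center $x$ and radius $r$; $|A|$ and $\chi_A$ are the Lebesgue measure and the characteristic function of $A$. The notation $\phi^{q}(t)$ means $(\phi(t))^{q}$. Class $\mathcal{G}_{q,p}$ ($1\le q,p\le\infty$): the set of measurable functions $\phi:(0,\infty)\to(0,\infty)$ such that (i) $t\mapsto t^{d/p}\phi(t)$ is almost decreasing: there is $C>0$ with $s^{d/p}\phi(s)\le C r^{d/p}\phi(r)$ whenever $0<r\le s$; and (ii) $t\mapsto t^{d/q}\phi(t)$ is almost increasing: there is $C>0$ with $r^{d/q}\phi(r)\le C s^{d/q}\phi(s)$ whenever $0<r\le s$. For $f\in L^{0}(\mathbb{R}^{d})$ and $r>0$, let ${}_{r}\|f\|_{q,p}\in[0,\infty]$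 be the $L^{p}(\mathbb{R}^{d})$-norm of the function $y\mapsto\|f\chi_{B(y,r)}\|_{L^{q}(\mathbb{R}^{d})}$. For $1\le q\le p\le\infty$ and $\phi\in\mathcal{G}_{q,p}$, set $$\|f\|_{(L^{q},L^{p})^{\phi}(\mathbb{R}^{d})}=\sup_{r>0}\frac{1}{\phi(r)}\,r^{d(-\frac1q-\frac1p)}\;{}_{r}\|f\|_{q,p},$$ and the generalized Fofana space is $(L^{q},L^{p})^{\phi}(\mathbb{R}^{d})=\{f\in L^{0}(\mathbb{R}^{d}):\|f\|_{(L^{q},L^{p})^{\phi}(\mathbb{R}^{d})}<\infty\}$. The Hardy-Littlewood maximal operator is $Mf(x)=\sup_{r>0}\frac{1}{|B(x,r)|}\int_{B(x,r)}|f(y)|\,dy$, $x\in\mathbb{R}^{d}$, for locally integrable $f$. *)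

theory Defs
  imports "HOL-Analysis.Analysis" "HOL-Probability.Essential_Supremum"
begin

text \<open>
  Exponents are extended nonnegative reals. Functions are measured through their absolute values,
  which take values in \<^typ>\<open>ennreal\<close>; this lets the same norm apply to a complex function and to its
  maximal function, which may be infinite at some points. Measurable functions stand for their
  classes modulo almost-everywhere equality.
\<close>

text \<open>The convention \<open>1 / \<infinity> = 0\<close> comes from division on \<^typ>\<open>ennreal\<close>.\<close>

definition recip :: "ennreal \<Rightarrow> real" where
  "recip q = enn2real (1 / q)"

text \<open>\<open>x\<^sup>a\<close> for \<open>x\<close> in \<open>[0,\<infinity>]\<close>; only meant for exponents \<open>a > 0\<close>.\<close>

definition ennreal_pow :: "ennreal \<Rightarrow> real \<Rightarrow> ennreal" where
  "ennreal_pow x a = (if x = \<infinity> then \<infinity> else ennreal (enn2real x powr a))"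

definition Lp_norm :: "ennreal \<Rightarrow> ('a::euclidean_space \<Rightarrow> ennreal) \<Rightarrow> ennreal" where
  "Lp_norm q g =
     (if q = \<infinity> then esssup lebesgue g
      else ennreal_pow (\<integral>\<^sup>+ x. ennreal_pow (g x) (enn2real q) \<partial>lebesgue) (1 / enn2real q))"

definition amalgam_norm ::
  "real \<Rightarrow> ennreal \<Rightarrow> ennreal \<Rightarrow> ('a::euclidean_space \<Rightarrow> ennreal) \<Rightarrow> ennreal" where
  "amalgam_norm r q p g = Lp_norm p (\<lambda>y. Lp_norm q (\<lambda>x. g x * indicator (ball y r) x))"

text \<open>The class \<open>\<G>\<^bsub>q,p\<^esub>\<close> in dimension \<open>d\<close>. Only the values on \<open>(0,\<infinity>)\<close> matter.\<close>

definition fofana_class :: "nat \<Rightarrow> ennreal \<Rightarrow> ennreal \<Rightarrow> (real \<Rightarrow> real) set" where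
  "fofana_class d q p =
     {\<phi>. \<phi> \<in> borel_measurable (lebesgue_on {0<..}) \<and>
         (\<forall>t>0. \<phi> t > 0) \<and>
         (\<exists>C>0. \<forall>r s. 0 < r \<and> r \<le> s \<longrightarrow>
            s powr (d * recip p) * \<phi> s \<le> C * (r powr (d * recip p) * \<phi> r)) \<and>
         (\<exists>C>0. \<forall>r s. 0 < r \<and> r \<le> s \<longrightarrow>
            r powr (d * recip q) * \<phi> r \<le> C * (s powr (d * recip q) * \<phi> s))}"

definition fofana_norm ::
  "ennreal \<Rightarrow> ennreal \<Rightarrow> (real \<Rightarrow> real) \<Rightarrow> ('a::euclidean_space \<Rightarrow> ennreal) \<Rightarrow> ennreal" where
  "fofana_norm q p \<phi> g =
     (SUP r\<in>{0<..}.
        ennreal (1 / \<phi> r * r powr (DIM('a) * (- recip q - recip p))) * amalgam_norm r q p g)"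

definition fofana_space ::
  "ennreal \<Rightarrow> ennreal \<Rightarrow> (real \<Rightarrow> real) \<Rightarrow> ('a::euclidean_space \<Rightarrow> complex) set" where
  "fofana_space q p \<phi> =
     {f \<in> borel_measurable lebesgue. fofana_norm q p \<phi> (\<lambda>x. ennreal (cmod (f x))) < \<infinity>}"

definition hl_maximal :: "('a::euclidean_space \<Rightarrow> complex) \<Rightarrow> 'a \<Rightarrow> ennreal" where
  "hl_maximal f x =
     (SUP r\<in>{0<..}.
        (\<integral>\<^sup>+ y\<in>ball x r. ennreal (cmod (f y)) \<partial>lebesgue) / emeasure lebesgue (ball x r))"

end

theory Submission
  imports Defs
begin

text \<open>
  Write \<open>h(y,R)\<close> for the integral of \<open>|f|\<^sup>q\<close> over \<open>B(y,R)\<close> and \<open>H(y,r)\<close> for that of \<open>(Mf)\<^sup>q\<close> over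
  \<open>B(y,r)\<close>. For a point of \<open>B(y,r)\<close>, averages over radii below \<open>r\<close> only see \<open>f\<close> on \<open>B(y,2r)\<close> and are
  controlled by the strong \<open>(q,q)\<close> inequality; averages over radii comparable to \<open>2\<^sup>k r\<close> are controlled,
  by Jensen, by \<open>h(y,2\<^sup>k\<^sup>+\<^sup>2 r)\<close>. Hence \<open>H(y,r)\<close> is at most a constant times the supremum over \<open>k \<ge> 1\<close>
  of \<open>2\<^sup>-\<^sup>k\<^sup>d h(y,2\<^sup>k r)\<close>. Keeping a supremum here, and not a sum, avoids Minkowski's inequality: for
  \<open>p < \<infinity>\<close> the \<open>p/q\<close>-th power of the supremum is bounded by the sum of the \<open>p/q\<close>-th powers, and
  integrating in \<open>y\<close> leaves the sum of \<open>a(2\<^sup>k r)\<^sup>p\<close> with \<open>a(t) = t\<^sup>d\<^sup>/\<^sup>p \<phi>(t)\<close>. As \<open>a\<close> is almost decreasing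
  and \<open>q \<le> p\<close>, it is dominated by \<open>a(r)\<^sup>p\<^sup>-\<^sup>q\<close> times the sum of \<open>a(2\<^sup>k r)\<^sup>q\<close>, which is what the integral
  hypothesis bounds. For \<open>q < p = \<infinity>\<close> the monotonicity of \<open>a\<close> suffices, and for
  \<open>q = p = \<infinity>\<close> every amalgam norm is the essential supremum of \<open>|f|\<close>.
\<close>

subsection \<open>Powers of extended nonnegative reals\<close>

lemma ennreal_pow_top [simp]: "ennreal_pow top a = top"
  by (simp add: ennreal_pow_def)

lemma ennreal_pow_ennreal: "0 \<le> x \<Longrightarrow> ennreal_pow (ennreal x) a = ennreal (x powr a)"
  by (simp add: ennreal_pow_def)

lemma ennreal_pow_0 [simp]: "ennreal_pow 0 a = 0"
  by (simp add: ennreal_pow_def)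

lemma ennreal_pow_one [simp]: "ennreal_pow x 1 = x"
  by (cases x) (simp_all add: ennreal_pow_ennreal)

lemma ennreal_pow_mono: "x \<le> y \<Longrightarrow> 0 \<le> a \<Longrightarrow> ennreal_pow x a \<le> ennreal_pow y a"
  by (cases x; cases y) (auto simp: ennreal_pow_ennreal top_unique intro!: ennreal_leI powr_mono2)

lemma ennreal_pow_pow: "ennreal_pow (ennreal_pow x a) b = ennreal_pow x (a * b)"
  by (cases x) (simp_all add: ennreal_pow_ennreal powr_powr)

lemma ennreal_pow_mult:
  assumes "0 < a"
  shows "ennreal_pow (x * y) a = ennreal_pow x a * ennreal_pow y a"
proof -
  have top: "ennreal_pow (top * z) a = top * ennreal_pow z a" for z
    using assms
    by (cases "z = 0"; cases z) (auto simp: ennreal_mult_eq_top_iff ennreal_top_mult ennreal_pow_ennreal ennreal_zero_less_mult_iff)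
  show ?thesis
  proof (cases "x = top \<or> y = top")
    case True
    then show ?thesis using top[of x] top[of y] by (auto simp: mult.commute)
  next
    case False
    then obtain u v where "x = ennreal u" "0 \<le> u" "y = ennreal v" "0 \<le> v"
      by (metis ennreal_cases infinity_ennreal_def)
    then show ?thesis
      by (simp add: ennreal_pow_ennreal powr_mult flip: ennreal_mult)
  qed
qed

text \<open>The powers with exponents a and 1/a are monotone and inverse to each other on
  [0,\<infinity>]. This is how the outer exponent of an \<open>Lp_norm\<close> is moved across an
  inequality.\<close>

lemma ennreal_pow_le_iff:
  assumes "0 < a"
  shows "ennreal_pow x a \<le> y \<longleftrightarrow> x \<le> ennreal_pow y (1 / a)"
proof
  assume "ennreal_pow x a \<le> y"
  then have "ennreal_pow (ennreal_pow x a) (1 / a) \<le> ennreal_pow y (1 / a)"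
    using assms by (intro ennreal_pow_mono) auto
  then show "x \<le> ennreal_pow y (1 / a)"
    using assms by (simp add: ennreal_pow_pow)
next
  assume "x \<le> ennreal_pow y (1 / a)"
  then have "ennreal_pow x a \<le> ennreal_pow (ennreal_pow y (1 / a)) a"
    using assms by (intro ennreal_pow_mono) auto
  then show "ennreal_pow x a \<le> y"
    using assms by (simp add: ennreal_pow_pow)
qed

text \<open>By \<open>ennreal_pow_le_iff\<close> the power is a left adjoint, so it passes through
  suprema with no continuity argument.\<close>

lemma ennreal_pow_SUP_le:
  assumes "0 < a"
  shows "ennreal_pow (SUP i\<in>I. f i) a \<le> (SUP i\<in>I. ennreal_pow (f i) a)"
  unfolding ennreal_pow_le_iff[OF assms]
proof (rule SUP_least)
  fix i assume "i \<in> I"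
  then show "f i \<le> ennreal_pow (SUP i\<in>I. ennreal_pow (f i) a) (1 / a)"
    unfolding ennreal_pow_le_iff[OF assms, symmetric] by (rule SUP_upper)
qed

lemma measurable_ennreal_pow [measurable]:
  assumes [measurable]: "f \<in> borel_measurable M"
  shows "(\<lambda>x. ennreal_pow (f x) a) \<in> borel_measurable M"
  unfolding ennreal_pow_def infinity_ennreal_def by measurable

subsection \<open>Integrals over balls\<close>

lemma set_nn_integral_set_mono:
  "A \<subseteq> B \<Longrightarrow> (\<integral>\<^sup>+x\<in>A. g x \<partial>M) \<le> (\<integral>\<^sup>+x\<in>B. g x \<partial>M)"
  by (intro nn_integral_mono) (auto split: split_indicator)

lemma divide_le_iff_ennreal:
  fixes a b c :: ennreal
  assumes "b \<noteq> 0" "b \<noteq> top"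
  shows "a / b \<le> c \<longleftrightarrow> a \<le> c * b"
proof
  assume "a / b \<le> c"
  then have "a / b * b \<le> c * b" by (rule mult_right_mono) simp
  then show "a \<le> c * b"
    using assms by (simp add: ennreal_divide_times top.not_eq_extremum)
next
  assume "a \<le> c * b"
  then have "a / b \<le> c * b / b" by (rule divide_right_mono_ennreal)
  then show "a / b \<le> c"
    using assms by (simp add: mult_divide_eq_ennreal)
qed

lemma emeasure_lebesgue_ball:
  fixes x :: "'a::euclidean_space"
  assumes "0 < r"
  shows "emeasure lebesgue (ball x r) = ennreal (unit_ball_vol DIM('a) * r ^ DIM('a))"
  using assms by (simp add: emeasure_ball)

text \<open>Lower semicontinuity in the center: the open ball is exhausted by the concentric balls
  of radius r - 1/n, and these stay inside B(z,r) when z is within 1/n of y. Measurability in the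
  center, and that of the maximal function, rests on this.\<close>

lemma open_ball_integral_gt:
  fixes g :: "'a::euclidean_space \<Rightarrow> ennreal"
  assumes [measurable]: "g \<in> borel_measurable lebesgue"
  shows "open {y. c < (\<integral>\<^sup>+x\<in>ball y r. g x \<partial>lebesgue)}"
proof -
  { fix y assume y: "c < (\<integral>\<^sup>+x\<in>ball y r. g x \<partial>lebesgue)"
    let ?s = "\<lambda>n. r - 1 / real (Suc n)"
    have ind: "(SUP n. g x * indicator (ball y (?s n)) x) = g x * indicator (ball y r) x" for x
    proof (intro antisym SUP_least)
      show "g x * indicator (ball y (?s n)) x \<le> g x * indicator (ball y r) x" for n
        by (auto split: split_indicator dest: less_le_trans[of _ _ r])
      show "g x * indicator (ball y r) x \<le> (SUP n. g x * indicator (ball y (?s n)) x)"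
      proof (cases "x \<in> ball y r")
        case True
        then obtain n where "inverse (of_nat (Suc n)) < r - dist y x"
          using reals_Archimedean[of "r - dist y x"] by auto
        then have "x \<in> ball y (?s n)" by (simp add: field_simps)
        then show ?thesis by (intro SUP_upper2[of n]) (auto split: split_indicator)
      qed simp
    qed
    have "(\<integral>\<^sup>+x\<in>ball y r. g x \<partial>lebesgue) = (SUP n. \<integral>\<^sup>+x\<in>ball y (?s n). g x \<partial>lebesgue)"
      unfolding ind[symmetric]
    proof (rule nn_integral_monotone_convergence_SUP)
      have "ball y (?s n) \<subseteq> ball y (?s (Suc n))" for n
        by (intro subset_ball) (simp add: frac_le)
      then show "incseq (\<lambda>n x. g x * indicator (ball y (?s n)) x)"
        by (intro incseq_SucI le_funI) (fastforce split: split_indicator)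
    qed (intro borel_measurable_times_ennreal borel_measurable_indicator assms, simp)
    then obtain n where n: "c < (\<integral>\<^sup>+x\<in>ball y (?s n). g x \<partial>lebesgue)"
      using y by (auto simp: less_SUP_iff)
    have "ball y (1 / real (Suc n)) \<subseteq> {y. c < (\<integral>\<^sup>+x\<in>ball y r. g x \<partial>lebesgue)}"
    proof
      fix z assume z: "z \<in> ball y (1 / real (Suc n))"
      have "ball y (?s n) \<subseteq> ball z r"
      proof
        fix w assume "w \<in> ball y (?s n)"
        then show "w \<in> ball z r"
          using z dist_triangle[of z w y] by (auto simp: dist_commute)
      qed
      then have "(\<integral>\<^sup>+x\<in>ball y (?s n). g x \<partial>lebesgue) \<le> (\<integral>\<^sup>+x\<in>ball z r. g x \<partial>lebesgue)"
        by (rule set_nn_integral_set_mono)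
      with n show "z \<in> {y. c < (\<integral>\<^sup>+x\<in>ball y r. g x \<partial>lebesgue)}" by auto
    qed
    then have "\<exists>e>0. ball y e \<subseteq> {y. c < (\<integral>\<^sup>+x\<in>ball y r. g x \<partial>lebesgue)}"
      by (intro exI[of _ "1 / real (Suc n)"]) auto }
  then show ?thesis by (auto simp: open_contains_ball)
qed

lemma borel_measurable_lebesgue_openI:
  fixes u :: "'a::euclidean_space \<Rightarrow> ennreal"
  assumes "\<And>c. open {x. c < u x}"
  shows "u \<in> borel_measurable lebesgue"
proof -
  have "u \<in> borel_measurable borel"
    using assms by (intro borel_measurableI_greater) auto
  then show ?thesis by (intro measurable_completion) auto
qed

lemma measurable_ball_integral [measurable]:
  fixes g :: "'a::euclidean_space \<Rightarrow> ennreal"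
  assumes "g \<in> borel_measurable lebesgue"
  shows "(\<lambda>y. \<integral>\<^sup>+x\<in>ball y r. g x \<partial>lebesgue) \<in> borel_measurable lebesgue"
  using open_ball_integral_gt[OF assms] by (rule borel_measurable_lebesgue_openI)

subsection \<open>The maximal inequality\<close>

text \<open>\<open>hl_maximal\<close> acts on complex functions, whereas the truncations and
  localizations below are extended nonnegative functions; hence the operator is restated for
  them.\<close>

definition maximal :: "('a::euclidean_space \<Rightarrow> ennreal) \<Rightarrow> 'a \<Rightarrow> ennreal" where
  "maximal g x = (SUP r\<in>{0<..}. (\<integral>\<^sup>+y\<in>ball x r. g y \<partial>lebesgue) / emeasure lebesgue (ball x r))"

lemma hl_maximal_eq: "hl_maximal f = maximal (\<lambda>x. ennreal (cmod (f x)))"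
  by (simp add: fun_eq_iff hl_maximal_def maximal_def)

text \<open>A superlevel set is a union over uncountably many radii, which preserves openness. Each
  average has open superlevel sets because the volume of the ball does not depend on its
  center.\<close>

lemma measurable_maximal [measurable]:
  fixes g :: "'a::euclidean_space \<Rightarrow> ennreal"
  assumes "g \<in> borel_measurable lebesgue"
  shows "maximal g \<in> borel_measurable lebesgue"
proof (rule borel_measurable_lebesgue_openI)
  fix c :: ennreal
  have "c < (\<integral>\<^sup>+y\<in>ball x r. g y \<partial>lebesgue) / emeasure lebesgue (ball x r) \<longleftrightarrow>
      c * ennreal (unit_ball_vol DIM('a) * r ^ DIM('a)) < (\<integral>\<^sup>+y\<in>ball x r. g y \<partial>lebesgue)"
    if "0 < r" for x r
    using that unfolding emeasure_lebesgue_ball[OF that]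
    by (subst (1 2) not_le[symmetric], subst divide_le_iff_ennreal) (auto simp: less_imp_neq[OF unit_ball_vol_pos, symmetric])
  then have "{x. c < maximal g x} = (\<Union>r\<in>{0<..}.
      {x. c * ennreal (unit_ball_vol DIM('a) * r ^ DIM('a)) < (\<integral>\<^sup>+y\<in>ball x r. g y \<partial>lebesgue)})"
    by (auto simp: maximal_def less_SUP_iff)
  then show "open {x. c < maximal g x}"
    using open_ball_integral_gt[OF assms] by auto
qed

text \<open>Makes Tonelli available on the product of \<open>lebesgue\<close> and
  \<open>lborel\<close>; the finite pieces are those of \<open>lborel\<close>.\<close>

lemma sigma_finite_lebesgue: "sigma_finite_measure (lebesgue :: 'a::euclidean_space measure)"
proof
  obtain A :: "'a set set" where "countable A" "A \<subseteq> sets lborel" "\<Union>A = space lborel"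
      "\<forall>a\<in>A. emeasure lborel a \<noteq> \<infinity>"
    using lborel.sigma_finite_countable by auto
  then show "\<exists>A::'a set set. countable A \<and> A \<subseteq> sets lebesgue \<and> \<Union>A = space lebesgue \<and>
      (\<forall>a\<in>A. emeasure lebesgue a \<noteq> \<infinity>)"
    by (intro exI[of _ A]) (auto simp: subset_eq)
qed

lemma emeasure_lebesgue_ball_neq:
  fixes x :: "'a::euclidean_space"
  assumes "0 < r"
  shows "emeasure lebesgue (ball x r) \<noteq> 0" "emeasure lebesgue (ball x r) \<noteq> top"
proof -
  have "0 < unit_ball_vol (real DIM('a)) * r ^ DIM('a)"
    using assms by simp
  then show "emeasure lebesgue (ball x r) \<noteq> 0" "emeasure lebesgue (ball x r) \<noteq> top"
    unfolding emeasure_lebesgue_ball[OF assms] by (simp_all only: ennreal_eq_0_iff not_le ennreal_neq_top not_False_eq_True)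
qed

lemma measurable_times_indicator_ball [simp, intro]:
  fixes g :: "'a::euclidean_space \<Rightarrow> ennreal"
  assumes "g \<in> borel_measurable lebesgue"
  shows "(\<lambda>x. g x * indicator (ball y r) x) \<in> borel_measurable lebesgue"
  by (intro borel_measurable_times_ennreal borel_measurable_indicator assms) simp

lemma set_nn_integral_ball_affine:
  fixes g :: "'a::euclidean_space \<Rightarrow> ennreal"
  assumes "g \<in> borel_measurable lebesgue"
  shows "(\<integral>\<^sup>+y\<in>ball x r. (a + b * g y) \<partial>lebesgue) =
    a * emeasure lebesgue (ball x r) + b * (\<integral>\<^sup>+y\<in>ball x r. g y \<partial>lebesgue)"
proof -
  have "(\<integral>\<^sup>+y\<in>ball x r. (a + b * g y) \<partial>lebesgue) =
      (\<integral>\<^sup>+y. a * indicator (ball x r) y + b * (g y * indicator (ball x r) y) \<partial>lebesgue)"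
    by (intro nn_integral_cong) (auto split: split_indicator)
  also have "\<dots> = (\<integral>\<^sup>+y. a * indicator (ball x r) y \<partial>lebesgue) +
      (\<integral>\<^sup>+y. b * (g y * indicator (ball x r) y) \<partial>lebesgue)"
    by (intro nn_integral_add borel_measurable_times_ennreal borel_measurable_const
      measurable_times_indicator_ball assms)
  also have "(\<integral>\<^sup>+y. a * indicator (ball x r) y \<partial>lebesgue) = a * emeasure lebesgue (ball x r)"
    by (intro nn_integral_cmult_indicator) simp
  also have "(\<integral>\<^sup>+y. b * (g y * indicator (ball x r) y) \<partial>lebesgue) =
      b * (\<integral>\<^sup>+y\<in>ball x r. g y \<partial>lebesgue)"
    by (intro nn_integral_cmult measurable_times_indicator_ball assms)
  finally show ?thesis .
qed

section \<open>Weak type (1,1) inequality\<close>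

lemma maximal_level_sets:
  fixes g :: "'a::euclidean_space \<Rightarrow> ennreal"
  assumes "g \<in> borel_measurable lebesgue"
  shows "{x. c < maximal g x} \<in> sets lebesgue"
proof -
  note measurable_maximal[OF assms, measurable]
  have "{x \<in> space lebesgue. c < maximal g x} \<in> sets lebesgue" by measurable
  then show ?thesis by simp
qed

text \<open>Around each point of the level set \<open>E\<close>, some ball has integral of g at
  least c times its volume. Vitali selects countably many disjoint ones whose fivefold enlargements
  cover \<open>E\<close>. Enlarging costs 5^d in volume, and disjointness bounds the sum of the
  integrals by the whole integral.\<close>

lemma maximal_weak_type:
  fixes g :: "'a::euclidean_space \<Rightarrow> ennreal"
  assumes [measurable]: "g \<in> borel_measurable lebesgue" and "0 < c"
  shows "ennreal c * emeasure lebesgue {x. ennreal c < maximal g x} \<le>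
    ennreal (5 ^ DIM('a)) * (\<integral>\<^sup>+x. g x \<partial>lebesgue)"
proof (cases "(\<integral>\<^sup>+x. g x \<partial>lebesgue) = top")
  case True
  then show ?thesis by (simp add: ennreal_mult_top)
next
  case False
  then obtain J where J: "(\<integral>\<^sup>+x. g x \<partial>lebesgue) = ennreal J" "0 \<le> J"
    by (cases "\<integral>\<^sup>+x. g x \<partial>lebesgue") auto
  define E where "E = {x. ennreal c < maximal g x}"
  define V where "V = unit_ball_vol DIM('a)"
  have V: "0 < V" by (simp add: V_def)
  have "\<exists>r>0. ennreal (c * V * r ^ DIM('a)) \<le> (\<integral>\<^sup>+y\<in>ball x r. g y \<partial>lebesgue)"
    if "x \<in> E" for x
  proof -
    have "ennreal c < (SUP r\<in>{0<..}. (\<integral>\<^sup>+y\<in>ball x r. g y \<partial>lebesgue) / emeasure lebesgue (ball x r))"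
      using that by (simp only: E_def maximal_def mem_Collect_eq)
    then obtain r where r: "0 < r"
      "ennreal c < (\<integral>\<^sup>+y\<in>ball x r. g y \<partial>lebesgue) / emeasure lebesgue (ball x r)"
      unfolding less_SUP_iff by (elim bexE) (simp only: greaterThan_iff)
    have "\<not> (\<integral>\<^sup>+y\<in>ball x r. g y \<partial>lebesgue) \<le> ennreal c * ennreal (V * r ^ DIM('a))"
      using r(2) emeasure_lebesgue_ball_neq[OF r(1), of x]
      unfolding V_def emeasure_lebesgue_ball[OF r(1), of x, symmetric]
      by (subst divide_le_iff_ennreal[symmetric]) (simp_all only: not_le not_False_eq_True)
    moreover have "ennreal (c * V * r ^ DIM('a)) = ennreal c * ennreal (V * r ^ DIM('a))"
      using r(1) V \<open>0 < c\<close> by (subst ennreal_mult[symmetric]) (auto simp: mult.assoc)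
    ultimately show ?thesis
      using r(1) by (intro exI[of _ r]) (auto simp only: not_le intro: less_imp_le)
  qed
  then obtain \<rho> where \<rho>: "\<And>x. x \<in> E \<Longrightarrow> 0 < \<rho> x"
      "\<And>x. x \<in> E \<Longrightarrow> ennreal (c * V * \<rho> x ^ DIM('a)) \<le> (\<integral>\<^sup>+y\<in>ball x (\<rho> x). g y \<partial>lebesgue)"
    by metis
  \<comment> \<open>The covering lemma needs bounded radii, which is why the integral was reduced to
    a finite \<open>J\<close>: c V \<rho>^d \<le> J, and \<rho> \<le> \<rho>^d once \<rho> >
    1.\<close>
  have bound: "\<rho> x \<le> max 1 (J / (c * V))" if "x \<in> E" for x
  proof (cases "\<rho> x \<le> 1")
    case False
    have "ennreal (c * V * \<rho> x ^ DIM('a)) \<le> (\<integral>\<^sup>+y\<in>ball x (\<rho> x). g y \<partial>lebesgue)"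
      by (rule \<rho>(2)[OF that])
    also have "\<dots> \<le> (\<integral>\<^sup>+y. g y \<partial>lebesgue)"
      by (intro nn_integral_mono) (auto split: split_indicator)
    finally have "c * V * \<rho> x ^ DIM('a) \<le> J"
      using J by simp
    moreover have "\<rho> x ^ 1 \<le> \<rho> x ^ DIM('a)"
      using False by (intro power_increasing) (auto simp: Suc_le_eq)
    ultimately have "\<rho> x \<le> J / (c * V)"
      using V \<open>0 < c\<close> by (simp add: field_simps) (smt (verit) mult_left_mono mult_pos_pos)
    then show ?thesis by simp
  qed simp
  obtain C where C: "countable C" "C \<subseteq> E"
      "pairwise (\<lambda>i j. disjnt (ball i (\<rho> i)) (ball j (\<rho> j))) C"
      "E \<subseteq> (\<Union>i\<in>C. ball i (5 * \<rho> i))"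
  proof (rule Vitali_covering_lemma_balls[where S = E and K = E and a = "\<lambda>x. x" and r = \<rho>])
    show "E \<subseteq> (\<Union>i\<in>E. ball i (\<rho> i))" using \<rho>(1) by force
  qed (use \<rho>(1) bound in auto)
  \<comment> \<open>Sums over the selected centers are written as integrals over
    \<open>count_space C\<close>, so that they can be exchanged with the integral in x. The enlarged
    balls cover each point of \<open>E\<close> at least once; the original balls cover each point at
    most once (\<open>disj\<close>).\<close>
  have one: "1 \<le> (\<integral>\<^sup>+i. indicator (ball i (5 * \<rho> i)) x \<partial>count_space C)" if "x \<in> E" for x
  proof -
    obtain j where j: "j \<in> C" "x \<in> ball j (5 * \<rho> j)" using C(4) \<open>x \<in> E\<close> by blast
    have "1 = (\<integral>\<^sup>+i. indicator {j} i \<partial>count_space C)"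
      using j(1) by (simp add: nn_integral_indicator)
    also have "\<dots> \<le> (\<integral>\<^sup>+i. indicator (ball i (5 * \<rho> i)) x \<partial>count_space C)"
      using j(2) by (intro nn_integral_mono) (auto split: split_indicator)
    finally show ?thesis .
  qed
  have disj: "(\<integral>\<^sup>+i. g x * indicator (ball i (\<rho> i)) x \<partial>count_space C) \<le> g x" for x
  proof (cases "\<exists>j\<in>C. x \<in> ball j (\<rho> j)")
    case True
    then obtain j where j: "j \<in> C" "x \<in> ball j (\<rho> j)" by blast
    have "x \<notin> ball i (\<rho> i)" if "i \<in> C" "i \<noteq> j" for i
      using C(3) that j unfolding pairwise_def disjnt_def by blast
    then have "(\<integral>\<^sup>+i. g x * indicator (ball i (\<rho> i)) x \<partial>count_space C) \<le>
        (\<integral>\<^sup>+i. g x * indicator {j} i \<partial>count_space C)"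
      by (intro nn_integral_mono) (auto split: split_indicator)
    also have "\<dots> = g x"
      using j(1) by (subst nn_integral_cmult) (auto simp: nn_integral_indicator)
    finally show ?thesis .
  next
    case False
    then have "(\<integral>\<^sup>+i. g x * indicator (ball i (\<rho> i)) x \<partial>count_space C) =
        (\<integral>\<^sup>+i. 0 \<partial>count_space C)"
      by (intro nn_integral_cong) auto
    then show ?thesis by simp
  qed
  have [measurable]: "E \<in> sets lebesgue"
    unfolding E_def by (rule maximal_level_sets[OF assms(1)])
  have "ennreal c * emeasure lebesgue E = (\<integral>\<^sup>+x. ennreal c * indicator E x \<partial>lebesgue)"
    by (simp add: nn_integral_cmult_indicator)
  also have "\<dots> \<le> (\<integral>\<^sup>+x. \<integral>\<^sup>+i. ennreal c * indicator (ball i (5 * \<rho> i)) x \<partial>count_space C \<partial>lebesgue)"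
  proof (rule nn_integral_mono)
    fix x
    show "ennreal c * indicator E x \<le> (\<integral>\<^sup>+i. ennreal c * indicator (ball i (5 * \<rho> i)) x \<partial>count_space C)"
    proof (cases "x \<in> E")
      case True
      then show ?thesis
        using mult_left_mono[OF one[OF True], of "ennreal c"] by (simp add: nn_integral_cmult)
    qed simp
  qed
  also have "\<dots> = (\<integral>\<^sup>+i. \<integral>\<^sup>+x. ennreal c * indicator (ball i (5 * \<rho> i)) x \<partial>lebesgue \<partial>count_space C)"
    by (rule nn_integral_count_space_nn_integral) (use C(1) in auto)
  also have "\<dots> \<le> (\<integral>\<^sup>+i. \<integral>\<^sup>+x. ennreal (5 ^ DIM('a)) * (g x * indicator (ball i (\<rho> i)) x) \<partial>lebesgue \<partial>count_space C)"
  proof (rule nn_integral_mono)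
    fix i assume "i \<in> space (count_space C)"
    then have i: "i \<in> E" using C(2) by auto
    have "(\<integral>\<^sup>+x. ennreal c * indicator (ball i (5 * \<rho> i)) x \<partial>lebesgue) =
        ennreal c * ennreal (V * (5 * \<rho> i) ^ DIM('a))"
      using \<rho>(1)[OF i] by (simp add: nn_integral_cmult_indicator emeasure_ball V_def)
    also have "\<dots> = ennreal (5 ^ DIM('a)) * ennreal (c * V * \<rho> i ^ DIM('a))"
      using V \<open>0 < c\<close> \<rho>(1)[OF i]
      by (simp add: power_mult_distrib mult_ac flip: ennreal_mult)
    also have "\<dots> \<le> ennreal (5 ^ DIM('a)) * (\<integral>\<^sup>+x. g x * indicator (ball i (\<rho> i)) x \<partial>lebesgue)"
      by (intro mult_left_mono \<rho>(2)[OF i]) simp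
    also have "\<dots> = (\<integral>\<^sup>+x. ennreal (5 ^ DIM('a)) * (g x * indicator (ball i (\<rho> i)) x) \<partial>lebesgue)"
      by (intro nn_integral_cmult[symmetric] measurable_times_indicator_ball assms(1))
    finally show "(\<integral>\<^sup>+x. ennreal c * indicator (ball i (5 * \<rho> i)) x \<partial>lebesgue) \<le>
      (\<integral>\<^sup>+x. ennreal (5 ^ DIM('a)) * (g x * indicator (ball i (\<rho> i)) x) \<partial>lebesgue)" .
  qed
  also have "\<dots> = (\<integral>\<^sup>+x. \<integral>\<^sup>+i. ennreal (5 ^ DIM('a)) * (g x * indicator (ball i (\<rho> i)) x) \<partial>count_space C \<partial>lebesgue)"
    by (rule nn_integral_count_space_nn_integral[OF C(1), symmetric])
      (intro borel_measurable_times_ennreal borel_measurable_const measurable_times_indicator_ball assms(1))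
  also have "\<dots> \<le> (\<integral>\<^sup>+x. ennreal (5 ^ DIM('a)) * g x \<partial>lebesgue)"
    using disj by (intro nn_integral_mono) (auto simp: nn_integral_cmult intro: mult_left_mono)
  also have "\<dots> = ennreal (5 ^ DIM('a)) * (\<integral>\<^sup>+x. g x \<partial>lebesgue)"
    by (rule nn_integral_cmult) measurable
  finally show ?thesis unfolding E_def .
qed

section \<open>Strong type inequality by truncation and integration over levels\<close>

text \<open>Truncation at half the level: \<open>h\<close> keeps g where 2g > c, so g \<le> h + c/2
  and an average of g exceeds that of \<open>h\<close> by at most c/2. Thus Mg > c forces Mh > c/2,
  and the weak type bound is applied to \<open>h\<close> at level c/2, whence the factor 2.\<close>

lemma maximal_level_le:
  fixes g :: "'a::euclidean_space \<Rightarrow> ennreal"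
  assumes [measurable]: "g \<in> borel_measurable lebesgue" and "0 < c"
  shows "ennreal c * emeasure lebesgue {x. ennreal c < maximal g x} \<le>
    ennreal (2 * 5 ^ DIM('a)) * (\<integral>\<^sup>+x. (if ennreal c < 2 * g x then g x else 0) \<partial>lebesgue)"
proof -
  define h where "h x = (if ennreal c < 2 * g x then g x else 0)" for x
  have [measurable]: "h \<in> borel_measurable lebesgue"
    unfolding h_def by measurable
  have gh: "g x \<le> h x + ennreal (c / 2)" for x
  proof (cases "g x")
    case (real u)
    then have "2 * g x = ennreal (2 * u)"
      by (simp add: ennreal_mult)
    then show ?thesis
      using \<open>0 < c\<close> real by (auto simp: h_def ennreal_less_iff intro: ennreal_leI)
  qed (simp add: h_def)
  have "{x. ennreal c < maximal g x} \<subseteq> {x. ennreal (c / 2) < maximal h x}"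
  proof (rule ccontr)
    assume "\<not> ?thesis"
    then obtain x where "ennreal c < maximal g x" "\<not> ennreal (c / 2) < maximal h x"
      by blast
    then have x: "ennreal c < maximal g x" "maximal h x \<le> ennreal (c / 2)"
      by (simp_all only: not_less)
    have "(\<integral>\<^sup>+y\<in>ball x r. g y \<partial>lebesgue) / emeasure lebesgue (ball x r) \<le> ennreal c" if "0 < r" for r
    proof -
      define v where "v = emeasure lebesgue (ball x r)"
      have v: "v \<noteq> 0" "v \<noteq> top"
        unfolding v_def by (rule emeasure_lebesgue_ball_neq[OF that])+
      have "(\<integral>\<^sup>+y\<in>ball x r. g y \<partial>lebesgue) \<le>
          (\<integral>\<^sup>+y\<in>ball x r. (ennreal (c / 2) + 1 * h y) \<partial>lebesgue)"
        using gh by (intro nn_integral_mono mult_right_mono) (simp_all add: add.commute)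
      also have "\<dots> = ennreal (c / 2) * v + (\<integral>\<^sup>+y\<in>ball x r. h y \<partial>lebesgue)"
        unfolding v_def by (subst set_nn_integral_ball_affine) simp_all
      also have "(\<integral>\<^sup>+y\<in>ball x r. h y \<partial>lebesgue) \<le> ennreal (c / 2) * v"
      proof -
        have "(\<integral>\<^sup>+y\<in>ball x r. h y \<partial>lebesgue) / v \<le> maximal h x"
          unfolding maximal_def v_def using that by (intro SUP_upper) auto
        then show ?thesis
          unfolding divide_le_iff_ennreal[OF v, symmetric] using x(2) by (rule order_trans)
      qed
      also have "ennreal (c / 2) * v + ennreal (c / 2) * v = ennreal c * v"
        using \<open>0 < c\<close> by (simp flip: distrib_right ennreal_plus)
      finally show ?thesis
        unfolding v_def[symmetric] divide_le_iff_ennreal[OF v] by (simp only: add_left_mono)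
    qed
    then have "maximal g x \<le> ennreal c"
      unfolding maximal_def by (intro SUP_least) auto
    with x(1) show False by simp
  qed
  then have "ennreal (c / 2) * emeasure lebesgue {x. ennreal c < maximal g x} \<le>
      ennreal (c / 2) * emeasure lebesgue {x. ennreal (c / 2) < maximal h x}"
    by (intro mult_left_mono emeasure_mono maximal_level_sets) simp_all
  also have "\<dots> \<le> ennreal (5 ^ DIM('a)) * (\<integral>\<^sup>+x. h x \<partial>lebesgue)"
    using \<open>0 < c\<close> by (intro maximal_weak_type) auto
  finally have "2 * (ennreal (c / 2) * emeasure lebesgue {x. ennreal c < maximal g x}) \<le>
      2 * (ennreal (5 ^ DIM('a)) * (\<integral>\<^sup>+x. h x \<partial>lebesgue))"
    by (intro mult_left_mono) auto
  moreover have "2 * (ennreal (c / 2) * z) = ennreal c * z" for z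
    unfolding mult.assoc[symmetric] using \<open>0 < c\<close> by (simp flip: ennreal_numeral ennreal_mult)
  moreover have "ennreal (2 * 5 ^ DIM('a)) = 2 * ennreal (5 ^ DIM('a))"
    by (simp add: ennreal_mult)
  ultimately show ?thesis
    by (simp only: h_def mult.assoc)
qed

text \<open>The layer-cake identity for one value: a power becomes an integral over the levels below
  it. The conditions on t sit inside the integrand so that, after Tonelli, a superlevel set in x
  appears.\<close>

lemma nn_integral_powr_less:
  fixes a :: ennreal
  assumes "0 < s"
  shows "(\<integral>\<^sup>+t. (if 0 < t \<and> ennreal t < a then ennreal (t powr (s - 1)) else 0) \<partial>lborel) =
    ennreal (1 / s) * ennreal_pow a s"
proof -
  have fin: "(\<integral>\<^sup>+t. (if 0 < t \<and> ennreal t < ennreal c then ennreal (t powr (s - 1)) else 0) \<partial>lborel) =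
      ennreal (1 / s) * ennreal_pow (ennreal c) s" if "0 \<le> c" for c
  proof -
    have "(\<integral>\<^sup>+t. (if 0 < t \<and> ennreal t < ennreal c then ennreal (t powr (s - 1)) else 0) \<partial>lborel) =
        (\<integral>\<^sup>+t. ennreal (t powr (s - 1)) * indicator {0..c} t \<partial>lborel)"
    proof (rule nn_integral_cong_AE)
      \<comment> \<open>The two integrands can differ only at t = c; at t = 0 they agree because
        \<open>0 powr (s - 1)\<close> is 0.\<close>
      have "AE t in lborel. t \<noteq> c" by (rule AE_lborel_singleton)
      then show "AE t in lborel. (if 0 < t \<and> ennreal t < ennreal c then ennreal (t powr (s - 1)) else 0) =
          ennreal (t powr (s - 1)) * indicator {0..c} t"
        by eventually_elim (auto simp: ennreal_less_iff split: split_indicator)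
    qed
    also have "\<dots> = ennreal (c powr (s - 1 + 1) / (s - 1 + 1))"
      using assms that by (intro nn_integral_has_integral_lebesgue' has_integral_powr_from_0) auto
    also have "\<dots> = ennreal (1 / s) * ennreal_pow (ennreal c) s"
      using assms that by (simp add: ennreal_pow_ennreal flip: ennreal_mult)
    finally show ?thesis .
  qed
  show ?thesis
  proof (cases a)
    case (real c)
    then show ?thesis using fin by simp
  next
    case top
    \<comment> \<open>For infinite \<open>a\<close> the integral dominates every real x: the
      truncation at level (s x)^(1/s) already has integral x.\<close>
    have *: "ennreal x \<le> (\<integral>\<^sup>+t. (if 0 < t \<and> ennreal t < a then ennreal (t powr (s - 1)) else 0) \<partial>lborel)"
      if "0 \<le> x" for x
    proof -
      have "ennreal x = ennreal (1 / s) * ennreal_pow (ennreal ((s * x) powr (1 / s))) s"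
        using assms that by (simp add: ennreal_pow_ennreal powr_powr flip: ennreal_mult)
      also have "\<dots> = (\<integral>\<^sup>+t. (if 0 < t \<and> ennreal t < ennreal ((s * x) powr (1 / s)) then ennreal (t powr (s - 1)) else 0) \<partial>lborel)"
        by (rule fin[symmetric]) simp
      also have "\<dots> \<le> (\<integral>\<^sup>+t. (if 0 < t \<and> ennreal t < a then ennreal (t powr (s - 1)) else 0) \<partial>lborel)"
        unfolding top by (intro nn_integral_mono) auto
      finally show ?thesis .
    qed
    have "(\<integral>\<^sup>+t. (if 0 < t \<and> ennreal t < a then ennreal (t powr (s - 1)) else 0) \<partial>lborel) = top"
      (is "?I = _")
    proof (cases ?I)
      case (real x)
      have "ennreal (x + 1) \<le> ?I" using real by (intro *) simp
      then show ?thesis using real by simp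
    qed
    then show ?thesis using top assms by (simp add: ennreal_mult_top)
  qed
qed

lemma ennreal_mult_pow_diff_1:
  assumes "1 < s"
  shows "x * ennreal_pow x (s - 1) = ennreal_pow x s"
proof (cases x)
  case (real c)
  then show ?thesis
    by (cases "c = 0") (simp_all add: ennreal_pow_ennreal powr_diff flip: ennreal_mult)
qed (simp add: ennreal_mult_top)

text \<open>Marcinkiewicz's argument: expand (Mg)^s over levels, insert
  \<open>maximal_level_le\<close>, and exchange the integrals back. The remaining integral of
  t^(s-2) over 0 < t < 2g converges because s > 1 and equals (2g)^(s-1)/(s-1), which gives the
  constant s * 2 * 5^d * 2^(s-1)/(s-1).\<close>

lemma maximal_strong_type:
  fixes g :: "'a::euclidean_space \<Rightarrow> ennreal"
  assumes [measurable]: "g \<in> borel_measurable lebesgue" and "1 < s"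
  shows "(\<integral>\<^sup>+x. ennreal_pow (maximal g x) s \<partial>lebesgue) \<le>
    ennreal (2 powr s * 5 ^ DIM('a) * s / (s - 1)) * (\<integral>\<^sup>+x. ennreal_pow (g x) s \<partial>lebesgue)"
proof -
  interpret leb: sigma_finite_measure "lebesgue :: 'a measure" by (rule sigma_finite_lebesgue)
  interpret P: pair_sigma_finite "lebesgue :: 'a measure" "lborel :: real measure" ..
  note measurable_maximal[OF assms(1), measurable]
  let ?K = "ennreal (2 * 5 ^ DIM('a))"
  have "(\<integral>\<^sup>+x. ennreal_pow (maximal g x) s \<partial>lebesgue) =
      (\<integral>\<^sup>+x. ennreal s * (\<integral>\<^sup>+t. (if 0 < t \<and> ennreal t < maximal g x then ennreal (t powr (s - 1)) else 0) \<partial>lborel) \<partial>lebesgue)"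
    using assms(2) by (subst nn_integral_powr_less) (auto simp flip: mult.assoc ennreal_mult)
  also have "\<dots> = ennreal s * (\<integral>\<^sup>+x. \<integral>\<^sup>+t. (if 0 < t \<and> ennreal t < maximal g x then ennreal (t powr (s - 1)) else 0) \<partial>lborel \<partial>lebesgue)"
    by (rule nn_integral_cmult) measurable
  also have "(\<integral>\<^sup>+x. \<integral>\<^sup>+t. (if 0 < t \<and> ennreal t < maximal g x then ennreal (t powr (s - 1)) else 0) \<partial>lborel \<partial>lebesgue) =
      (\<integral>\<^sup>+t. \<integral>\<^sup>+x. (if 0 < t \<and> ennreal t < maximal g x then ennreal (t powr (s - 1)) else 0) \<partial>lebesgue \<partial>lborel)"
    by (rule P.Fubini'[symmetric]) measurable
  \<comment> \<open>The bound at level t brings a factor 1/t and lowers the exponent to s - 2. It is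
    written \<open>s - 1 - 1\<close> so that \<open>nn_integral_powr_less\<close> applies with s - 1
    in place of s.\<close>
  also have "\<dots> \<le> (\<integral>\<^sup>+t. \<integral>\<^sup>+x. ?K * (if 0 < t \<and> ennreal t < 2 * g x then ennreal (t powr (s - 1 - 1)) * g x else 0) \<partial>lebesgue \<partial>lborel)"
  proof (rule nn_integral_mono)
    fix t :: real
    show "(\<integral>\<^sup>+x. (if 0 < t \<and> ennreal t < maximal g x then ennreal (t powr (s - 1)) else 0) \<partial>lebesgue) \<le>
        (\<integral>\<^sup>+x. ?K * (if 0 < t \<and> ennreal t < 2 * g x then ennreal (t powr (s - 1 - 1)) * g x else 0) \<partial>lebesgue)"
    proof (cases "0 < t")
      case True
      have "(\<integral>\<^sup>+x. (if 0 < t \<and> ennreal t < maximal g x then ennreal (t powr (s - 1)) else 0) \<partial>lebesgue) =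
          (\<integral>\<^sup>+x. ennreal (t powr (s - 1)) * indicator {x. ennreal t < maximal g x} x \<partial>lebesgue)"
        using True by (intro nn_integral_cong) auto
      also have "\<dots> = ennreal (t powr (s - 1)) * emeasure lebesgue {x. ennreal t < maximal g x}"
        by (rule nn_integral_cmult_indicator) (rule maximal_level_sets[OF assms(1)])
      also have "\<dots> = ennreal (t powr (s - 1 - 1)) * (ennreal t * emeasure lebesgue {x. ennreal t < maximal g x})"
        using True by (simp add: powr_diff power2_eq_square flip: mult.assoc ennreal_mult)
      also have "\<dots> \<le> ennreal (t powr (s - 1 - 1)) * (?K * (\<integral>\<^sup>+x. (if ennreal t < 2 * g x then g x else 0) \<partial>lebesgue))"
        by (intro mult_left_mono maximal_level_le assms True) simp
      also have "\<dots> = (\<integral>\<^sup>+x. ennreal (t powr (s - 1 - 1)) * (?K * (if ennreal t < 2 * g x then g x else 0)) \<partial>lebesgue)"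
        by (simp add: nn_integral_cmult)
      also have "\<dots> = (\<integral>\<^sup>+x. ?K * (if 0 < t \<and> ennreal t < 2 * g x then ennreal (t powr (s - 1 - 1)) * g x else 0) \<partial>lebesgue)"
        using True by (intro nn_integral_cong) (auto simp: mult_ac)
      finally show ?thesis .
    qed simp
  qed
  also have "\<dots> = (\<integral>\<^sup>+x. \<integral>\<^sup>+t. ?K * (if 0 < t \<and> ennreal t < 2 * g x then ennreal (t powr (s - 1 - 1)) * g x else 0) \<partial>lborel \<partial>lebesgue)"
    by (rule P.Fubini') measurable
  also have "\<dots> = (\<integral>\<^sup>+x. ?K * g x * (\<integral>\<^sup>+t. (if 0 < t \<and> ennreal t < 2 * g x then ennreal (t powr (s - 1 - 1)) else 0) \<partial>lborel) \<partial>lebesgue)"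
    by (intro nn_integral_cong, subst nn_integral_cmult[symmetric]) (auto intro!: nn_integral_cong simp: mult_ac)
  also have "\<dots> = (\<integral>\<^sup>+x. ?K * g x * (ennreal (1 / (s - 1)) * ennreal_pow (2 * g x) (s - 1)) \<partial>lebesgue)"
    using assms(2) by (subst nn_integral_powr_less) auto
  also have "\<dots> = (\<integral>\<^sup>+x. ennreal (2 powr s * 5 ^ DIM('a) / (s - 1)) * ennreal_pow (g x) s \<partial>lebesgue)"
  proof (rule nn_integral_cong)
    fix x
    have "ennreal_pow (2 * g x) (s - 1) = ennreal (2 powr (s - 1)) * ennreal_pow (g x) (s - 1)"
      using assms(2) by (subst ennreal_pow_mult) (simp_all add: ennreal_pow_ennreal flip: ennreal_numeral)
    then have "?K * g x * (ennreal (1 / (s - 1)) * ennreal_pow (2 * g x) (s - 1)) =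
        (?K * ennreal (1 / (s - 1)) * ennreal (2 powr (s - 1))) * (g x * ennreal_pow (g x) (s - 1))"
      by (simp add: mult_ac)
    also have "?K * ennreal (1 / (s - 1)) * ennreal (2 powr (s - 1)) = ennreal (2 powr s * 5 ^ DIM('a) / (s - 1))"
      using assms(2) by (simp add: powr_diff field_simps flip: ennreal_mult)
    finally show "?K * g x * (ennreal (1 / (s - 1)) * ennreal_pow (2 * g x) (s - 1)) =
        ennreal (2 powr s * 5 ^ DIM('a) / (s - 1)) * ennreal_pow (g x) s"
      using assms(2) by (simp add: ennreal_mult_pow_diff_1)
  qed
  also have "\<dots> = ennreal (2 powr s * 5 ^ DIM('a) / (s - 1)) * (\<integral>\<^sup>+x. ennreal_pow (g x) s \<partial>lebesgue)"
    by (rule nn_integral_cmult) measurable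
  finally have "(\<integral>\<^sup>+x. ennreal_pow (maximal g x) s \<partial>lebesgue) \<le>
      ennreal s * (ennreal (2 powr s * 5 ^ DIM('a) / (s - 1)) * (\<integral>\<^sup>+x. ennreal_pow (g x) s \<partial>lebesgue))"
    by (simp add: mult_left_mono)
  also have "\<dots> = ennreal (2 powr s * 5 ^ DIM('a) * s / (s - 1)) * (\<integral>\<^sup>+x. ennreal_pow (g x) s \<partial>lebesgue)"
    using assms(2) by (subst mult.assoc[symmetric], subst ennreal_mult[symmetric]) (auto simp: mult_ac)
  finally show ?thesis .
qed

section \<open>Powers of averages\<close>

text \<open>With \<open>a\<close> half of the average of \<open>u\<close>, this gives Jensen's inequality up to the factor \<open>2\<^sup>s\<close>.\<close>

lemma le_add_ennreal_pow:
  assumes "0 < a" "1 < s"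
  shows "u \<le> ennreal a + ennreal (a powr (1 - s)) * ennreal_pow u s"
proof (cases u)
  case (real c)
  show ?thesis
  proof (cases "c \<le> a")
    case True
    then show ?thesis using real by (auto intro: add_increasing2 ennreal_leI)
  next
    case False
    then have "c * 1 \<le> c * (c / a) powr (s - 1)"
      using assms by (intro mult_left_mono ge_one_powr_ge_zero) auto
    also have "\<dots> = a powr (1 - s) * c powr s"
      using assms False by (simp add: powr_divide powr_diff field_simps)
    finally show ?thesis
      using assms real by (auto simp: ennreal_pow_ennreal simp flip: ennreal_mult intro!: add_increasing ennreal_leI)
  qed
qed (use assms in \<open>simp add: ennreal_mult_top\<close>)

text \<open>Averaging \<open>le_add_ennreal_pow\<close> gives A \<le> a + a^(1-s) J for every a > 0,
  with J the average of g^s. For a = A/2 the first term is absorbed on the left, leaving A^s \<le>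
  2^s J.\<close>

lemma average_pow_le:
  fixes g :: "'a::euclidean_space \<Rightarrow> ennreal"
  assumes [measurable]: "g \<in> borel_measurable lebesgue" and "1 < s" "0 < r"
  shows "ennreal_pow ((\<integral>\<^sup>+y\<in>ball x r. g y \<partial>lebesgue) / emeasure lebesgue (ball x r)) s \<le>
    ennreal (2 powr s) * ((\<integral>\<^sup>+y\<in>ball x r. ennreal_pow (g y) s \<partial>lebesgue) / emeasure lebesgue (ball x r))"
proof -
  define v where "v = emeasure lebesgue (ball x r)"
  define J where "J = (\<integral>\<^sup>+y\<in>ball x r. ennreal_pow (g y) s \<partial>lebesgue) / v"
  define A where "A = (\<integral>\<^sup>+y\<in>ball x r. g y \<partial>lebesgue) / v"
  have v: "v \<noteq> 0" "v \<noteq> top"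
    unfolding v_def by (rule emeasure_lebesgue_ball_neq[OF assms(3)])+
  have *: "A \<le> ennreal a + ennreal (a powr (1 - s)) * J" if "0 < a" for a
  proof -
    have "(\<integral>\<^sup>+y\<in>ball x r. g y \<partial>lebesgue) \<le>
        (\<integral>\<^sup>+y\<in>ball x r. (ennreal a + ennreal (a powr (1 - s)) * ennreal_pow (g y) s) \<partial>lebesgue)"
      by (intro nn_integral_mono mult_right_mono le_add_ennreal_pow that assms(2)) simp
    also have "\<dots> = ennreal a * v + ennreal (a powr (1 - s)) * (\<integral>\<^sup>+y\<in>ball x r. ennreal_pow (g y) s \<partial>lebesgue)"
      unfolding v_def by (rule set_nn_integral_ball_affine) measurable
    also have "\<dots> = (ennreal a + ennreal (a powr (1 - s)) * J) * v"
      using v by (simp add: J_def distrib_right mult.assoc ennreal_divide_times top.not_eq_extremum)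
    finally show ?thesis
      unfolding A_def using v by (subst divide_le_iff_ennreal)
  qed
  have "ennreal_pow A s \<le> ennreal (2 powr s) * J"
  proof (cases "J = top")
    case True
    then show ?thesis by (simp add: ennreal_mult_top)
  next
    case False
    then obtain j where j: "J = ennreal j" "0 \<le> j" by (cases J) auto
    \<comment> \<open>The choice a = 1 makes A finite, so that A/2 can be subtracted
      afterwards.\<close>
    have "A \<noteq> top" using *[of 1] j by (auto simp: top_unique)
    then obtain b where b: "A = ennreal b" "0 \<le> b" by (cases A) auto
    show ?thesis
    proof (cases "b = 0")
      case False
      then have "0 < b" using b by simp
      then have "b \<le> b / 2 + (b / 2) powr (1 - s) * j"
        using *[of "b / 2"] b j by (simp flip: ennreal_mult ennreal_plus)
      then have "(b / 2) powr (s - 1) * (b / 2) \<le> (b / 2) powr (s - 1) * ((b / 2) powr (1 - s) * j)"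
        by (intro mult_left_mono) auto
      also have "\<dots> = j"
        using \<open>0 < b\<close> by (simp add: powr_add[symmetric] flip: mult.assoc)
      finally have "b powr s \<le> 2 powr s * j"
        using \<open>0 < b\<close> by (simp add: powr_diff powr_divide field_simps)
      then show ?thesis
        using b j by (simp add: ennreal_pow_ennreal ennreal_leI flip: ennreal_mult)
    qed (simp add: b)
  qed
  then show ?thesis by (simp add: A_def J_def v_def)
qed

lemma ennreal_pow_times_indicator:
  "ennreal_pow (u * indicator A x) s = ennreal_pow u s * indicator A x"
  by (auto split: split_indicator)

subsection \<open>The local estimate\<close>

lemma dyadic_scale:
  fixes r t :: real
  assumes "0 < r" "r \<le> t"
  obtains k where "2 ^ k * r \<le> t" "t < 2 ^ Suc k * r"
proof -
  obtain n where "t / r < 2 ^ n"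
    using real_arch_pow[of 2 "t / r"] by auto
  moreover have "\<not> t / r < 2 ^ 0"
    using assms by simp
  ultimately obtain k where "\<forall>i\<le>k. \<not> t / r < 2 ^ i" "t / r < 2 ^ Suc k"
    using ex_least_nat_less[of "\<lambda>n. t / r < 2 ^ n" n] by auto
  then show thesis
    using assms by (intro that[of k]) (auto simp: field_simps not_less)
qed

text \<open>The supremum does not depend on x, so the far part is constant on B(y,r). The near part
  involves g cut off to B(y,2r), to which the global strong type inequality can be applied.\<close>

lemma maximal_pow_le:
  fixes g :: "'a::euclidean_space \<Rightarrow> ennreal"
  assumes [measurable]: "g \<in> borel_measurable lebesgue" and "1 < s" "0 < r" and x: "x \<in> ball y r"
  shows "ennreal_pow (maximal g x) s \<le>
    ennreal_pow (maximal (\<lambda>z. g z * indicator (ball y (2 * r)) z) x) s +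
    ennreal (2 powr s * 4 ^ DIM('a) / (unit_ball_vol DIM('a) * r ^ DIM('a))) *
      (SUP k. ennreal ((1 / 2 ^ Suc k) ^ DIM('a)) *
        (\<integral>\<^sup>+z\<in>ball y (2 ^ Suc k * r). ennreal_pow (g z) s \<partial>lebesgue))"
    (is "_ \<le> ?near + ennreal ?L * ?T")
proof -
  let ?g1 = "\<lambda>z. g z * indicator (ball y (2 * r)) z"
  let ?avg = "\<lambda>t. (\<integral>\<^sup>+z\<in>ball x t. g z \<partial>lebesgue) / emeasure lebesgue (ball x t)"
  have "ennreal_pow (maximal g x) s \<le> (SUP t\<in>{0<..}. ennreal_pow (?avg t) s)"
    unfolding maximal_def using assms(2) by (intro ennreal_pow_SUP_le) simp
  also have "\<dots> \<le> ?near + ennreal ?L * ?T"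
  proof (rule SUP_least)
    fix t :: real assume "t \<in> {0<..}"
    then have t: "0 < t" by simp
    show "ennreal_pow (?avg t) s \<le> ?near + ennreal ?L * ?T"
    proof (cases "t < r")
      case True
      have "ball x t \<subseteq> ball y (2 * r)"
      proof
        fix z assume "z \<in> ball x t"
        then show "z \<in> ball y (2 * r)"
          using x True dist_triangle[of y z x] by auto
      qed
      then have "(\<integral>\<^sup>+z\<in>ball x t. g z \<partial>lebesgue) = (\<integral>\<^sup>+z\<in>ball x t. ?g1 z \<partial>lebesgue)"
        by (intro nn_integral_cong) (auto split: split_indicator)
      then have "?avg t \<le> maximal ?g1 x"
        unfolding maximal_def using t by (intro SUP_upper2[of t]) (simp_all only: greaterThan_iff order_refl)
      then have "ennreal_pow (?avg t) s \<le> ?near"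
        using assms(2) by (intro ennreal_pow_mono) simp_all
      then show ?thesis by (simp add: add_increasing2)
    next
      case False
      \<comment> \<open>The lower bound on t controls the volume of B(x,t) from below. The upper
        bound gives t + r < 2^(k+2) r, so B(x,t) lies in the ball that has index
        \<open>Suc k\<close> in the supremum.\<close>
      then obtain k where k: "2 ^ k * r \<le> t" "t < 2 ^ Suc k * r"
        using dyadic_scale[of r t] assms(3) by auto
      define V where "V = unit_ball_vol DIM('a)"
      have V: "0 < V" by (simp add: V_def)
      define D where "D = (2 ^ k * r) ^ DIM('a)"
      have D: "0 < D" using assms(3) by (simp add: D_def)
      let ?h = "\<integral>\<^sup>+z\<in>ball y (2 ^ Suc (Suc k) * r). ennreal_pow (g z) s \<partial>lebesgue"
      have "ball x t \<subseteq> ball y (2 ^ Suc (Suc k) * r)"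
      proof
        fix z assume "z \<in> ball x t"
        then show "z \<in> ball y (2 ^ Suc (Suc k) * r)"
          using x False k dist_triangle[of y z x] by auto
      qed
      then have sub: "(\<integral>\<^sup>+z\<in>ball x t. ennreal_pow (g z) s \<partial>lebesgue) \<le> ?h"
        by (rule set_nn_integral_set_mono)
      have vol: "ennreal (V * D) \<le> emeasure lebesgue (ball x t)"
        unfolding emeasure_lebesgue_ball[OF t] V_def[symmetric] D_def using V k assms(3)
        by (intro ennreal_leI mult_left_mono power_mono) auto
      have "ennreal_pow (?avg t) s \<le>
          ennreal (2 powr s) * ((\<integral>\<^sup>+z\<in>ball x t. ennreal_pow (g z) s \<partial>lebesgue) / emeasure lebesgue (ball x t))"
        by (intro average_pow_le assms t)
      also have "\<dots> \<le> ennreal (2 powr s) * (?h / ennreal (V * D))"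
      proof (rule mult_left_mono)
        have "?h = ?h / ennreal (V * D) * ennreal (V * D)"
          using V D by (simp add: ennreal_divide_times)
        also have "\<dots> \<le> ?h / ennreal (V * D) * emeasure lebesgue (ball x t)"
          by (intro mult_left_mono vol) simp
        finally show "(\<integral>\<^sup>+z\<in>ball x t. ennreal_pow (g z) s \<partial>lebesgue) / emeasure lebesgue (ball x t) \<le>
            ?h / ennreal (V * D)"
          unfolding divide_le_iff_ennreal[OF emeasure_lebesgue_ball_neq[OF t]] using sub by (rule order_trans[rotated])
      qed simp
      also have "\<dots> = ennreal (2 powr s / (V * D)) * ?h"
        using V D unfolding ennreal_divide_times[symmetric] by (subst divide_ennreal) auto
      \<comment> \<open>The volume is measured at radius 2^k r, while the weight belongs to radius
        2^(k+2) r; these two doublings account for 4^d.\<close>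
      also have "2 powr s / (V * D) = ?L * (1 / 2 ^ Suc (Suc k)) ^ DIM('a)"
        using assms(3) V by (simp add: D_def V_def[symmetric] power_mult_distrib power_divide field_simps
          flip: power_mult power_add)
      also have "ennreal \<dots> * ?h = ennreal ?L * (ennreal ((1 / 2 ^ Suc (Suc k)) ^ DIM('a)) * ?h)"
        using assms(3) V unfolding V_def by (subst ennreal_mult) (auto simp: mult.assoc)
      also have "\<dots> \<le> ennreal ?L * ?T"
        by (intro mult_left_mono SUP_upper2[of "Suc k"]) simp_all
      finally show ?thesis by (simp add: add_increasing)
    qed
  qed
  finally show ?thesis .
qed

text \<open>Integrating \<open>maximal_pow_le\<close> over B(y,r): the volume of the ball cancels
  the denominator of the far constant, and the near part is handled by the strong type
  inequality.\<close>

lemma ball_integral_maximal_pow_le: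
  fixes g :: "'a::euclidean_space \<Rightarrow> ennreal"
  assumes meas: "g \<in> borel_measurable lebesgue" and "1 < s" "0 < r"
  shows "(\<integral>\<^sup>+x\<in>ball y r. ennreal_pow (maximal g x) s \<partial>lebesgue) \<le>
    ennreal (2 powr s * 10 ^ DIM('a) * s / (s - 1) + 2 powr s * 4 ^ DIM('a)) *
      (SUP k. ennreal ((1 / 2 ^ Suc k) ^ DIM('a)) *
        (\<integral>\<^sup>+z\<in>ball y (2 ^ Suc k * r). ennreal_pow (g z) s \<partial>lebesgue))"
    (is "_ \<le> _ * ?T")
proof -
  let ?g1 = "\<lambda>z. g z * indicator (ball y (2 * r)) z"
  let ?L = "2 powr s * 4 ^ DIM('a) / (unit_ball_vol DIM('a) * r ^ DIM('a))"
  let ?K = "2 powr s * 5 ^ DIM('a) * s / (s - 1)"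
  have g1: "?g1 \<in> borel_measurable lebesgue"
    by (rule measurable_times_indicator_ball[OF meas])
  have "(\<integral>\<^sup>+z. ennreal_pow (?g1 z) s \<partial>lebesgue) \<le> ennreal (2 ^ DIM('a)) * ?T"
  proof -
    \<comment> \<open>The term k = 0 of the supremum has radius 2r and weight 2^(-d). Removing the
      weight costs 2^d, which turns 5^d into 10^d in the final constant.\<close>
    have "(\<integral>\<^sup>+z. ennreal_pow (?g1 z) s \<partial>lebesgue) =
        ennreal (2 ^ DIM('a)) * (ennreal ((1 / 2 ^ Suc 0) ^ DIM('a)) *
          (\<integral>\<^sup>+z\<in>ball y (2 ^ Suc 0 * r). ennreal_pow (g z) s \<partial>lebesgue))"
      by (simp add: ennreal_pow_times_indicator power_divide flip: mult.assoc ennreal_mult)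
    also have "\<dots> \<le> ennreal (2 ^ DIM('a)) * ?T"
      by (intro mult_left_mono SUP_upper) simp_all
    finally show ?thesis .
  qed
  then have "ennreal ?K * (\<integral>\<^sup>+z. ennreal_pow (?g1 z) s \<partial>lebesgue) \<le> ennreal ?K * (ennreal (2 ^ DIM('a)) * ?T)"
    by (rule mult_left_mono) simp
  then have near: "(\<integral>\<^sup>+x. ennreal_pow (maximal ?g1 x) s \<partial>lebesgue) \<le> ennreal ?K * (ennreal (2 ^ DIM('a)) * ?T)"
    using maximal_strong_type[OF g1 assms(2)] by (rule order_trans[rotated])
  have "(\<integral>\<^sup>+x\<in>ball y r. ennreal_pow (maximal g x) s \<partial>lebesgue) \<le>
      (\<integral>\<^sup>+x\<in>ball y r. (ennreal ?L * ?T + 1 * ennreal_pow (maximal ?g1 x) s) \<partial>lebesgue)"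
  proof (rule nn_integral_mono)
    fix x
    show "ennreal_pow (maximal g x) s * indicator (ball y r) x \<le>
        (ennreal ?L * ?T + 1 * ennreal_pow (maximal ?g1 x) s) * indicator (ball y r) x"
    proof (cases "x \<in> ball y r")
      case True
      then show ?thesis
        using maximal_pow_le[OF assms True] by (simp add: add.commute)
    qed simp
  qed
  also have "\<dots> = ennreal ?L * ?T * emeasure lebesgue (ball y r) +
      1 * (\<integral>\<^sup>+x\<in>ball y r. ennreal_pow (maximal ?g1 x) s \<partial>lebesgue)"
    by (intro set_nn_integral_ball_affine measurable_ennreal_pow measurable_maximal g1)
  also have "\<dots> \<le> ennreal ?L * ?T * emeasure lebesgue (ball y r) + ennreal ?K * (ennreal (2 ^ DIM('a)) * ?T)"
  proof (rule add_left_mono)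
    have "(\<integral>\<^sup>+x\<in>ball y r. ennreal_pow (maximal ?g1 x) s \<partial>lebesgue) \<le> (\<integral>\<^sup>+x. ennreal_pow (maximal ?g1 x) s \<partial>lebesgue)"
      by (intro nn_integral_mono) (auto split: split_indicator)
    with near show "1 * (\<integral>\<^sup>+x\<in>ball y r. ennreal_pow (maximal ?g1 x) s \<partial>lebesgue) \<le>
        ennreal ?K * (ennreal (2 ^ DIM('a)) * ?T)"
      by simp
  qed
  also have "ennreal ?L * ?T * emeasure lebesgue (ball y r) =
      ennreal (?L * (unit_ball_vol DIM('a) * r ^ DIM('a))) * ?T"
    unfolding emeasure_lebesgue_ball[OF assms(3)] using assms(3)
    by (subst ennreal_mult) (auto simp: mult_ac)
  also have "?L * (unit_ball_vol DIM('a) * r ^ DIM('a)) = 2 powr s * 4 ^ DIM('a)"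
    using assms(3) by (simp add: less_imp_neq[OF unit_ball_vol_pos, symmetric])
  also have "ennreal ?K * (ennreal (2 ^ DIM('a)) * ?T) = ennreal (?K * 2 ^ DIM('a)) * ?T"
    using assms(2) by (subst ennreal_mult) (auto simp: mult_ac)
  also have "?K * 2 ^ DIM('a) = 2 powr s * 10 ^ DIM('a) * s / (s - 1)"
    by (simp flip: power_mult_distrib)
  also have "ennreal (2 powr s * 4 ^ DIM('a)) * ?T + ennreal (2 powr s * 10 ^ DIM('a) * s / (s - 1)) * ?T =
      ennreal (2 powr s * 10 ^ DIM('a) * s / (s - 1) + 2 powr s * 4 ^ DIM('a)) * ?T"
    using assms(2) by (subst ennreal_plus) (auto simp: distrib_right add.commute)
  finally show ?thesis .
qed

section \<open>From the integral hypothesis to sums over dyadic scales\<close>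

text \<open>On the block (2^k r, 2^(k+1) r], almost monotonicity gives a(t) \<ge> a(2^(k+1) r)/B,
  and 1/t integrates to at least 1/2; summing over blocks bounds the sum of q-th powers. The other p
  - q powers are bounded by (B a(r))^(p-q).\<close>

lemma dyadic_sum_le:
  fixes a :: "real \<Rightarrow> real"
  assumes pos: "\<And>t. 0 < t \<Longrightarrow> 0 < a t"
    and B: "0 < B" "\<And>t u. 0 < t \<Longrightarrow> t \<le> u \<Longrightarrow> a u \<le> B * a t"
    and C: "0 < C" "(\<integral>\<^sup>+t\<in>{r<..}. ennreal (a t powr q / t) \<partial>lebesgue) \<le> ennreal (C * a r powr q)"
    and "0 < q" "q \<le> p" "0 < r"
  shows "(\<Sum>k. ennreal (a (2 ^ Suc k * r) powr p)) \<le> ennreal (2 * C * B powr p * a r powr p)"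
proof -
  define A where "A k = {2 ^ k * r<..2 ^ Suc k * r}" for k
  \<comment> \<open>A lower bound for a(t)^q/t on \<open>A k\<close>, with t replaced by the right
    endpoint in numerator and denominator. Multiplied by the length 2^k r it leaves half the
    numerator.\<close>
  define b where "b k = B powr (- q) * a (2 ^ Suc k * r) powr q / (2 ^ Suc k * r)" for k
  have disj: "disjoint_family A"
  proof -
    have "A i \<inter> A j = {}" if "i < j" for i j
    proof -
      have "2 ^ Suc i * r \<le> 2 ^ j * r"
        using that \<open>0 < r\<close> by (intro mult_right_mono power_increasing) auto
      then show ?thesis by (auto simp: A_def)
    qed
    then show ?thesis
      unfolding disjoint_family_on_def by (metis inf_commute linorder_neqE_nat)
  qed
  have b_le: "b k \<le> a t powr q / t" "r < t" if "t \<in> A k" for k t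
  proof -
    have t: "2 ^ k * r < t" "t \<le> 2 ^ Suc k * r"
      using that by (auto simp: A_def)
    moreover have "1 * r \<le> 2 ^ k * r"
      using \<open>0 < r\<close> by (intro mult_right_mono) auto
    ultimately show "r < t" by simp
    then have "0 < t" using \<open>0 < r\<close> by simp
    have "a (2 ^ Suc k * r) powr q \<le> (B * a t) powr q"
      using B(2)[OF \<open>0 < t\<close> t(2)] pos[of "2 ^ Suc k * r"] \<open>0 < r\<close> \<open>0 < q\<close>
      by (intro powr_mono2) auto
    also have "\<dots> = B powr q * a t powr q"
      by (rule powr_mult)
    finally have "B powr (- q) * a (2 ^ Suc k * r) powr q \<le> B powr (- q) * (B powr q * a t powr q)"
      by (intro mult_left_mono) auto
    also have "\<dots> = a t powr q"
      using B(1) by (simp add: powr_add[symmetric] flip: mult.assoc)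
    finally show "b k \<le> a t powr q / t"
      unfolding b_def using t(2) \<open>0 < t\<close> by (intro frac_le) auto
  qed
  have "(\<Sum>k. ennreal (B powr (- q) / 2 * a (2 ^ Suc k * r) powr q)) =
      (\<Sum>k. \<integral>\<^sup>+t. ennreal (b k) * indicator (A k) t \<partial>lebesgue)"
  proof (intro arg_cong[where f = suminf] ext)
    fix k
    have "(\<integral>\<^sup>+t. ennreal (b k) * indicator (A k) t \<partial>lebesgue) = ennreal (b k) * ennreal (2 ^ k * r)"
      using \<open>0 < r\<close> unfolding A_def by (subst nn_integral_cmult_indicator) (auto simp: mult.commute)
    also have "\<dots> = ennreal (B powr (- q) / 2 * a (2 ^ Suc k * r) powr q)"
      using \<open>0 < r\<close> unfolding b_def by (subst ennreal_mult[symmetric]) (auto simp: field_simps)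
    finally show "ennreal (B powr (- q) / 2 * a (2 ^ Suc k * r) powr q) =
        (\<integral>\<^sup>+t. ennreal (b k) * indicator (A k) t \<partial>lebesgue)" ..
  qed
  also have "\<dots> = (\<integral>\<^sup>+t. (\<Sum>k. ennreal (b k) * indicator (A k) t) \<partial>lebesgue)"
    by (intro nn_integral_suminf[symmetric] borel_measurable_times_ennreal borel_measurable_const
      borel_measurable_indicator) (simp add: A_def)
  also have "\<dots> \<le> (\<integral>\<^sup>+t\<in>{r<..}. ennreal (a t powr q / t) \<partial>lebesgue)"
  proof (rule nn_integral_mono)
    fix t
    show "(\<Sum>k. ennreal (b k) * indicator (A k) t) \<le> ennreal (a t powr q / t) * indicator {r<..} t"
    proof (cases "\<exists>k. t \<in> A k")
      case True
      then obtain k where k: "t \<in> A k" by blast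
      then show ?thesis
        using b_le[OF k] by (simp add: suminf_cmult_indicator[OF disj k] ennreal_leI)
    qed simp
  qed
  also note C(2)
  finally have sum_q: "(\<Sum>k. ennreal (B powr (- q) / 2 * a (2 ^ Suc k * r) powr q)) \<le> ennreal (C * a r powr q)" .
  have "(\<Sum>k. ennreal (a (2 ^ Suc k * r) powr p)) \<le>
      (\<Sum>k. ennreal (2 * B powr p * a r powr (p - q)) * ennreal (B powr (- q) / 2 * a (2 ^ Suc k * r) powr q))"
  proof (intro suminf_le)
    fix k
    have ak: "0 < a (2 ^ Suc k * r)" "0 < a r"
      using pos \<open>0 < r\<close> by auto
    have "1 * r \<le> 2 ^ Suc k * r"
      using \<open>0 < r\<close> by (intro mult_right_mono one_le_power) auto
    then have "a (2 ^ Suc k * r) \<le> B * a r"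
      using B(2)[OF \<open>0 < r\<close>] by simp
    then have "a (2 ^ Suc k * r) powr (p - q) \<le> (B * a r) powr (p - q)"
      using ak \<open>q \<le> p\<close> by (intro powr_mono2) auto
    then have "a (2 ^ Suc k * r) powr (p - q) * a (2 ^ Suc k * r) powr q \<le>
        (B * a r) powr (p - q) * a (2 ^ Suc k * r) powr q"
      by (rule mult_right_mono) simp
    then have "a (2 ^ Suc k * r) powr p \<le> (B * a r) powr (p - q) * a (2 ^ Suc k * r) powr q"
      using ak by (simp flip: powr_add)
    \<comment> \<open>The second factor is arranged to be the summand of \<open>sum_q\<close>; the
      compensating 2 B^q merges with B^(p-q) into 2 B^p.\<close>
    also have "\<dots> = (2 * B powr p * a r powr (p - q)) * (B powr (- q) / 2 * a (2 ^ Suc k * r) powr q)"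
      using B(1) ak by (simp add: powr_mult powr_diff powr_minus field_simps)
    finally show "ennreal (a (2 ^ Suc k * r) powr p) \<le>
        ennreal (2 * B powr p * a r powr (p - q)) * ennreal (B powr (- q) / 2 * a (2 ^ Suc k * r) powr q)"
      by (subst ennreal_mult[symmetric]) (auto intro: ennreal_leI)
  qed auto
  also have "\<dots> \<le> ennreal (2 * B powr p * a r powr (p - q)) * ennreal (C * a r powr q)"
    unfolding ennreal_suminf_cmult using sum_q by (rule mult_left_mono) simp
  also have "\<dots> = ennreal (2 * C * B powr p * a r powr p)"
    using C(1) pos[OF \<open>0 < r\<close>] by (subst ennreal_mult[symmetric]) (auto simp: powr_diff)
  finally show ?thesis .
qed

subsection \<open>Generalized Fofana norms\<close>

lemma recip_ennreal: "0 < s \<Longrightarrow> recip (ennreal s) = 1 / s"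
proof -
  assume "0 < s"
  then have "1 / ennreal s = ennreal (1 / s)"
    by (simp add: divide_ennreal flip: ennreal_1)
  then show ?thesis using \<open>0 < s\<close> by (simp add: recip_def)
qed

lemma recip_top [simp]: "recip top = 0"
  by (simp add: recip_def)

lemma Lp_norm_ball:
  fixes g :: "'a::euclidean_space \<Rightarrow> ennreal"
  assumes "0 < s"
  shows "Lp_norm (ennreal s) (\<lambda>x. g x * indicator (ball y r) x) =
    ennreal_pow (\<integral>\<^sup>+x\<in>ball y r. ennreal_pow (g x) s \<partial>lebesgue) (1 / s)"
  using assms by (simp add: Lp_norm_def ennreal_pow_times_indicator)

lemma amalgam_norm_finite:
  fixes g :: "'a::euclidean_space \<Rightarrow> ennreal"
  assumes "0 < s" "0 < m"
  shows "amalgam_norm r (ennreal s) (ennreal m) g =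
    ennreal_pow (\<integral>\<^sup>+y. ennreal_pow (\<integral>\<^sup>+x\<in>ball y r. ennreal_pow (g x) s \<partial>lebesgue) (m / s) \<partial>lebesgue) (1 / m)"
  unfolding amalgam_norm_def Lp_norm_ball[OF assms(1)]
  using assms(2) by (simp add: Lp_norm_def ennreal_pow_pow)

lemma amalgam_norm_top:
  fixes g :: "'a::euclidean_space \<Rightarrow> ennreal"
  assumes "0 < s"
  shows "amalgam_norm r (ennreal s) top g =
    esssup lebesgue (\<lambda>y. ennreal_pow (\<integral>\<^sup>+x\<in>ball y r. ennreal_pow (g x) s \<partial>lebesgue) (1 / s))"
  unfolding amalgam_norm_def Lp_norm_ball[OF assms(1)] by (simp add: Lp_norm_def)

text \<open>Clears the division by \<phi>. It serves both to read off the bound for g at each radius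
  and to assemble the bound for its maximal function.\<close>

lemma fofana_norm_le_iff:
  fixes g :: "'a::euclidean_space \<Rightarrow> ennreal"
  assumes "\<And>t. 0 < t \<Longrightarrow> 0 < \<phi> t"
  shows "fofana_norm q p \<phi> g \<le> B \<longleftrightarrow>
    (\<forall>r>0. amalgam_norm r q p g \<le> ennreal (\<phi> r * r powr (DIM('a) * (recip q + recip p))) * B)"
proof -
  have "ennreal (1 / \<phi> r * r powr (DIM('a) * (- recip q - recip p))) * N \<le> B \<longleftrightarrow>
      N \<le> ennreal (\<phi> r * r powr (DIM('a) * (recip q + recip p))) * B" if "0 < r" for r N
  proof -
    define c where "c = \<phi> r * r powr (DIM('a) * (recip q + recip p))"
    have c: "0 < c" using assms[OF that] that by (simp add: c_def)
    have "real DIM('a) * (- recip q - recip p) = - (DIM('a) * (recip q + recip p))"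
      by (simp add: algebra_simps)
    then have "1 / \<phi> r * r powr (DIM('a) * (- recip q - recip p)) = 1 / c"
      by (simp only: c_def powr_minus) (simp add: divide_inverse)
    moreover have "ennreal (1 / c) * N = N / ennreal c"
      using c by (simp add: divide_ennreal_def inverse_ennreal inverse_eq_divide mult.commute)
    ultimately show ?thesis
      using c by (simp add: divide_le_iff_ennreal mult.commute flip: c_def)
  qed
  then show ?thesis by (auto simp: fofana_norm_def SUP_le_iff)
qed

text \<open>The decay of the weight 2^(-kd) exactly cancels the growth of the volume scale, so only
  the factor involving \<phi> still depends on k.\<close>

lemma powr_dyadic_weight:
  fixes r :: real
  assumes "0 < r"
  shows "((1 / 2 ^ k) ^ d) powr z * (2 ^ k * r) powr (real d * z) = r powr (real d * z)"
proof -
  have "((1 / 2 ^ k) ^ d) powr z = (1 / 2 ^ k :: real) powr (real d * z)"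
    by (simp add: powr_powr flip: powr_realpow)
  then show ?thesis
    using assms by (simp flip: powr_mult)
qed

lemma ennreal_pow_SUP_le_suminf:
  fixes f :: "nat \<Rightarrow> ennreal"
  assumes "0 < a"
  shows "ennreal_pow (SUP k. f k) a \<le> (\<Sum>k. ennreal_pow (f k) a)"
proof -
  have "ennreal_pow (f k) a \<le> (\<Sum>k. ennreal_pow (f k) a)" for k
    using sum_le_suminf[of "\<lambda>k. ennreal_pow (f k) a" "{k}"] by simp
  then have "(SUP k. ennreal_pow (f k) a) \<le> (\<Sum>k. ennreal_pow (f k) a)"
    by (rule SUP_least)
  then show ?thesis
    by (rule order_trans[OF ennreal_pow_SUP_le[OF assms]])
qed

section \<open>Both exponents finite\<close>

lemma fofana_maximal_finite:
  fixes \<phi> :: "real \<Rightarrow> real"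
  defines "d \<equiv> DIM('a::euclidean_space)"
  assumes sm: "1 < s" "s \<le> m"
    and \<phi>: "\<And>t. 0 < t \<Longrightarrow> 0 < \<phi> t"
    and B: "0 < B" "\<And>t u. 0 < t \<Longrightarrow> t \<le> u \<Longrightarrow> u powr (d / m) * \<phi> u \<le> B * (t powr (d / m) * \<phi> t)"
    and C: "0 < C" "\<And>r. 0 < r \<Longrightarrow> (\<integral>\<^sup>+t\<in>{r<..}. ennreal (\<phi> t powr s * t powr (d * s / m - 1)) \<partial>lebesgue)
      \<le> ennreal (C * (\<phi> r powr s * r powr (d * s / m)))"
  shows "\<exists>C'>0. \<forall>g :: 'a \<Rightarrow> ennreal. g \<in> borel_measurable lebesgue \<longrightarrow>
    fofana_norm (ennreal s) (ennreal m) \<phi> (maximal g) \<le> ennreal C' * fofana_norm (ennreal s) (ennreal m) \<phi> g"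
proof -
  define K where "K = 2 powr s * 10 ^ d * s / (s - 1) + 2 powr s * 4 ^ d"
  have K: "0 < K" unfolding K_def using sm by (intro add_pos_pos divide_pos_pos mult_pos_pos) auto
  define a where "a t = t powr (d / m) * \<phi> t" for t
  define C0 where "C0 = 2 * C * B powr m"
  have C0: "0 < C0" using C(1) B(1) by (simp add: C0_def)
  have m: "0 < m" "0 < s" using sm by auto
  \<comment> \<open>In terms of \<open>a\<close>, the integrand of the hypothesis is a(t)^s/t, as
    \<open>dyadic_sum_le\<close> requires with q = s and p = m.\<close>
  have a_sum: "(\<Sum>k. ennreal (a (2 ^ Suc k * r) powr m)) \<le> ennreal (C0 * a r powr m)" if "0 < r" for r
    unfolding C0_def
  proof (rule dyadic_sum_le[where q = s])
    have "(\<integral>\<^sup>+t\<in>{r<..}. ennreal (a t powr s / t) \<partial>lebesgue) =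
        (\<integral>\<^sup>+t\<in>{r<..}. ennreal (\<phi> t powr s * t powr (d * s / m - 1)) \<partial>lebesgue)"
    proof (rule nn_integral_cong)
      fix t
      show "ennreal (a t powr s / t) * indicator {r<..} t =
          ennreal (\<phi> t powr s * t powr (d * s / m - 1)) * indicator {r<..} t"
      proof (cases "r < t")
        case True
        then have "0 < t" using that by simp
        then have "a t powr s / t = \<phi> t powr s * t powr (d * s / m - 1)"
          by (simp add: a_def powr_mult powr_powr powr_diff)
        then show ?thesis by simp
      qed simp
    qed
    also have "\<dots> \<le> ennreal (C * (\<phi> r powr s * r powr (d * s / m)))"
      by (rule C(2)[OF that])
    also have "\<phi> r powr s * r powr (d * s / m) = a r powr s"
      by (simp add: a_def powr_mult powr_powr)
    finally show "(\<integral>\<^sup>+t\<in>{r<..}. ennreal (a t powr s / t) \<partial>lebesgue) \<le> ennreal (C * a r powr s)" .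
  qed (use sm that B C(1) \<phi> in \<open>auto simp: a_def\<close>)
  \<comment> \<open>The estimate is made for m-th powers: K^(m/s) comes from the local estimate and
    \<open>C0\<close> from the dyadic sum, hence the m-th root.\<close>
  define C' where "C' = (K powr (m / s) * C0) powr (1 / m)"
  have "fofana_norm (ennreal s) (ennreal m) \<phi> (maximal g) \<le> ennreal C' * fofana_norm (ennreal s) (ennreal m) \<phi> g"
    if g: "g \<in> borel_measurable lebesgue" for g :: "'a \<Rightarrow> ennreal"
  proof -
    define F where "F = fofana_norm (ennreal s) (ennreal m) \<phi> g"
    define h where "h y R = (\<integral>\<^sup>+x\<in>ball y R. ennreal_pow (g x) s \<partial>lebesgue)" for y R
    have h [measurable]: "(\<lambda>y. h y R) \<in> borel_measurable lebesgue" for R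
      unfolding h_def using g by (intro measurable_ball_integral measurable_ennreal_pow)
    define c where "c R = \<phi> R * R powr (d * (1 / s + 1 / m))" for R
    \<comment> \<open>\<open>c R\<close> is the reciprocal of the normalizing factor in
      \<open>fofana_norm\<close>. Its m-th power splits into a(R)^m, which is summed over scales,
      and R^(dm/s), which the dyadic weight cancels.\<close>
    have c_eq: "c R powr m = a R powr m * R powr (d * (m / s))" for R
    proof -
      have "d * (1 / s + 1 / m) * m = d / m * m + d * (m / s)"
        using m by (simp add: field_simps)
      then show ?thesis
        by (simp only: c_def a_def powr_mult powr_powr powr_add mult_ac)
    qed
    have norm_eq: "fofana_norm (ennreal s) (ennreal m) \<phi> u \<le> X \<longleftrightarrow>
        (\<forall>R>0. amalgam_norm R (ennreal s) (ennreal m) u \<le> ennreal (c R) * X)" for u :: "'a \<Rightarrow> ennreal" and X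
      using fofana_norm_le_iff[OF \<phi>, where q = "ennreal s" and p = "ennreal m" and g = u and B = X] m
      by (simp add: recip_ennreal c_def d_def)
    have amalgam: "(\<integral>\<^sup>+y. ennreal_pow (h y R) (m / s) \<partial>lebesgue) \<le> ennreal (c R powr m) * ennreal_pow F m"
      if "0 < R" for R
    proof -
      have "amalgam_norm R (ennreal s) (ennreal m) g \<le> ennreal (c R) * F"
        using norm_eq[of g F] that by (simp add: F_def)
      then have "(\<integral>\<^sup>+y. ennreal_pow (h y R) (m / s) \<partial>lebesgue) \<le> ennreal_pow (ennreal (c R) * F) m"
        using m by (simp add: amalgam_norm_finite h_def ennreal_pow_le_iff)
      also have "\<dots> = ennreal (c R powr m) * ennreal_pow F m"
        using m \<phi>[OF that] by (simp add: ennreal_pow_mult ennreal_pow_ennreal c_def)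
      finally show ?thesis .
    qed
    have "amalgam_norm r (ennreal s) (ennreal m) (maximal g) \<le> ennreal (c r) * (ennreal C' * F)"
      if r: "0 < r" for r
    proof -
      define W where "W k = ((1 / 2 ^ Suc k) ^ d :: real)" for k
      let ?R = "\<lambda>k. 2 ^ Suc k * r"
      have "(\<integral>\<^sup>+y. ennreal_pow (\<integral>\<^sup>+x\<in>ball y r. ennreal_pow (maximal g x) s \<partial>lebesgue) (m / s) \<partial>lebesgue) \<le>
          (\<integral>\<^sup>+y. ennreal (K powr (m / s)) * (\<Sum>k. ennreal (W k powr (m / s)) * ennreal_pow (h y (?R k)) (m / s)) \<partial>lebesgue)"
      proof (rule nn_integral_mono)
        fix y
        have "ennreal_pow (\<integral>\<^sup>+x\<in>ball y r. ennreal_pow (maximal g x) s \<partial>lebesgue) (m / s) \<le>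
            ennreal_pow (ennreal K * (SUP k. ennreal (W k) * h y (?R k))) (m / s)"
          unfolding K_def W_def h_def d_def using m
          by (intro ennreal_pow_mono ball_integral_maximal_pow_le g sm r) simp
        also have "\<dots> = ennreal (K powr (m / s)) * ennreal_pow (SUP k. ennreal (W k) * h y (?R k)) (m / s)"
          using m K by (simp add: ennreal_pow_mult ennreal_pow_ennreal)
        also have "\<dots> \<le> ennreal (K powr (m / s)) * (\<Sum>k. ennreal_pow (ennreal (W k) * h y (?R k)) (m / s))"
          using m by (intro mult_left_mono ennreal_pow_SUP_le_suminf) auto
        also have "(\<Sum>k. ennreal_pow (ennreal (W k) * h y (?R k)) (m / s)) =
            (\<Sum>k. ennreal (W k powr (m / s)) * ennreal_pow (h y (?R k)) (m / s))"
          using m by (simp add: ennreal_pow_mult ennreal_pow_ennreal W_def)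
        finally show "ennreal_pow (\<integral>\<^sup>+x\<in>ball y r. ennreal_pow (maximal g x) s \<partial>lebesgue) (m / s) \<le>
            ennreal (K powr (m / s)) * (\<Sum>k. ennreal (W k powr (m / s)) * ennreal_pow (h y (?R k)) (m / s))" .
      qed
      also have "\<dots> = ennreal (K powr (m / s)) *
          (\<Sum>k. ennreal (W k powr (m / s)) * (\<integral>\<^sup>+y. ennreal_pow (h y (?R k)) (m / s) \<partial>lebesgue))"
        by (simp add: nn_integral_cmult nn_integral_suminf)
      also have "\<dots> \<le> ennreal (K powr (m / s)) *
          (\<Sum>k. ennreal (r powr (d * (m / s))) * ennreal_pow F m * ennreal (a (?R k) powr m))"
      proof (intro mult_left_mono suminf_le)
        fix k
        have "ennreal (W k powr (m / s)) * (\<integral>\<^sup>+y. ennreal_pow (h y (?R k)) (m / s) \<partial>lebesgue) \<le>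
            ennreal (W k powr (m / s)) * (ennreal (c (?R k) powr m) * ennreal_pow F m)"
          using r by (intro mult_left_mono amalgam) auto
        also have "\<dots> = ennreal (W k powr (m / s) * ?R k powr (d * (m / s)) * a (?R k) powr m) * ennreal_pow F m"
          by (simp add: c_eq ennreal_mult mult_ac)
        also have "W k powr (m / s) * ?R k powr (d * (m / s)) = r powr (d * (m / s))"
          unfolding W_def by (rule powr_dyadic_weight[OF r])
        finally show "ennreal (W k powr (m / s)) * (\<integral>\<^sup>+y. ennreal_pow (h y (?R k)) (m / s) \<partial>lebesgue) \<le>
            ennreal (r powr (d * (m / s))) * ennreal_pow F m * ennreal (a (?R k) powr m)"
          by (simp add: ennreal_mult mult_ac)
      qed auto
      also have "\<dots> = ennreal (K powr (m / s)) *
          (ennreal (r powr (d * (m / s))) * ennreal_pow F m * (\<Sum>k. ennreal (a (?R k) powr m)))"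
        by (simp only: ennreal_suminf_cmult)
      also have "\<dots> \<le> ennreal (K powr (m / s)) *
          (ennreal (r powr (d * (m / s))) * ennreal_pow F m * ennreal (C0 * a r powr m))"
        by (intro mult_left_mono a_sum r) auto
      also have "\<dots> = ennreal (c r powr m) * (ennreal (K powr (m / s) * C0) * ennreal_pow F m)"
        using C0 by (simp add: c_eq ennreal_mult mult_ac)
      also have "\<dots> = ennreal_pow (ennreal (c r) * (ennreal C' * F)) m"
        using m C0 K \<phi>[OF r] by (simp add: ennreal_pow_mult ennreal_pow_ennreal C'_def powr_powr c_def)
      finally show ?thesis
        using m by (simp add: amalgam_norm_finite ennreal_pow_le_iff)
    qed
    then show ?thesis
      using norm_eq by (simp add: F_def)
  qed
  moreover have "0 < C'" using K C0 by (simp add: C'_def)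
  ultimately show ?thesis by blast
qed

section \<open>Finite q and infinite p\<close>

text \<open>Here d/p = 0, so almost decreasing refers to \<phi> itself. After cancellation of the
  weights each term of the supremum is at most B c(r) times the norm of g, so the supremum is
  bounded term by term.\<close>

lemma fofana_maximal_top:
  fixes \<phi> :: "real \<Rightarrow> real"
  assumes s: "1 < s"
    and \<phi>: "\<And>t. 0 < t \<Longrightarrow> 0 < \<phi> t"
    and B: "0 < B" "\<And>t u. 0 < t \<Longrightarrow> t \<le> u \<Longrightarrow> \<phi> u \<le> B * \<phi> t"
  shows "\<exists>C'>0. \<forall>g :: 'a::euclidean_space \<Rightarrow> ennreal. g \<in> borel_measurable lebesgue \<longrightarrow>
    fofana_norm (ennreal s) top \<phi> (maximal g) \<le> ennreal C' * fofana_norm (ennreal s) top \<phi> g"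
proof -
  define d where "d = DIM('a)"
  define K where "K = 2 powr s * 10 ^ d * s / (s - 1) + 2 powr s * 4 ^ d"
  have K: "0 < K" unfolding K_def using s by (intro add_pos_pos divide_pos_pos mult_pos_pos) auto
  have s0: "0 < s" using s by simp
  define C' where "C' = K powr (1 / s) * B"
  have "fofana_norm (ennreal s) top \<phi> (maximal g) \<le> ennreal C' * fofana_norm (ennreal s) top \<phi> g"
    if g: "g \<in> borel_measurable lebesgue" for g :: "'a \<Rightarrow> ennreal"
  proof -
    define F where "F = fofana_norm (ennreal s) top \<phi> g"
    define h where "h y R = (\<integral>\<^sup>+x\<in>ball y R. ennreal_pow (g x) s \<partial>lebesgue)" for y R
    define c where "c R = \<phi> R * R powr (d * (1 / s))" for R
    have norm_eq: "fofana_norm (ennreal s) top \<phi> u \<le> X \<longleftrightarrow>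
        (\<forall>R>0. amalgam_norm R (ennreal s) top u \<le> ennreal (c R) * X)" for u :: "'a \<Rightarrow> ennreal" and X
      using fofana_norm_le_iff[OF \<phi>, where q = "ennreal s" and p = top and g = u and B = X] s0
      by (simp add: recip_ennreal c_def d_def)
    have "amalgam_norm r (ennreal s) top (maximal g) \<le> ennreal (c r) * (ennreal C' * F)"
      if r: "0 < r" for r
    proof -
      define W where "W k = ((1 / 2 ^ Suc k) ^ d :: real)" for k
      let ?R = "\<lambda>k. 2 ^ Suc k * r"
      have "AE y in lebesgue. ennreal_pow (h y (?R k)) (1 / s) \<le> ennreal (c (?R k)) * F" for k
      proof -
        have "amalgam_norm (?R k) (ennreal s) top g \<le> ennreal (c (?R k)) * F"
          using norm_eq[of g F] r by (simp add: F_def)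
        then have "esssup lebesgue (\<lambda>y. ennreal_pow (h y (?R k)) (1 / s)) \<le> ennreal (c (?R k)) * F"
          unfolding amalgam_norm_top[OF s0] h_def .
        then show ?thesis
          using esssup_AE[where M = lebesgue and f = "\<lambda>y. ennreal_pow (h y (?R k)) (1 / s)"] by (auto elim: order_trans)
      qed
      \<comment> \<open>The exceptional null set depends on k; countably many scales leave a single
        null set.\<close>
      then have "AE y in lebesgue. \<forall>k. ennreal_pow (h y (?R k)) (1 / s) \<le> ennreal (c (?R k)) * F"
        by (simp add: AE_all_countable)
      then have "AE y in lebesgue. ennreal_pow (\<integral>\<^sup>+x\<in>ball y r. ennreal_pow (maximal g x) s \<partial>lebesgue) (1 / s) \<le>
          ennreal (c r) * (ennreal C' * F)"
      proof eventually_elim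
        case (elim y)
        have "ennreal_pow (\<integral>\<^sup>+x\<in>ball y r. ennreal_pow (maximal g x) s \<partial>lebesgue) (1 / s) \<le>
            ennreal_pow (ennreal K * (SUP k. ennreal (W k) * h y (?R k))) (1 / s)"
          unfolding K_def W_def h_def d_def using s0
          by (intro ennreal_pow_mono ball_integral_maximal_pow_le g s r) simp
        also have "\<dots> = ennreal (K powr (1 / s)) * ennreal_pow (SUP k. ennreal (W k) * h y (?R k)) (1 / s)"
          using s0 K by (simp add: ennreal_pow_mult ennreal_pow_ennreal)
        also have "\<dots> \<le> ennreal (K powr (1 / s)) * (SUP k. ennreal_pow (ennreal (W k) * h y (?R k)) (1 / s))"
          using s0 by (intro mult_left_mono ennreal_pow_SUP_le) auto
        also have "\<dots> \<le> ennreal (K powr (1 / s)) * (ennreal (B * c r) * F)"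
        proof (intro mult_left_mono SUP_least)
          fix k
          have "1 * r \<le> ?R k"
            using r by (intro mult_right_mono one_le_power) auto
          then have \<phi>_le: "\<phi> (?R k) \<le> B * \<phi> r"
            using B(2)[OF r] by simp
          have "ennreal_pow (ennreal (W k) * h y (?R k)) (1 / s) =
              ennreal (W k powr (1 / s)) * ennreal_pow (h y (?R k)) (1 / s)"
            using s0 by (simp add: ennreal_pow_mult ennreal_pow_ennreal W_def)
          also have "\<dots> \<le> ennreal (W k powr (1 / s)) * (ennreal (c (?R k)) * F)"
            using elim by (intro mult_left_mono) auto
          also have "\<dots> = ennreal (W k powr (1 / s) * c (?R k)) * F"
            using \<phi>[of "?R k"] r by (simp add: ennreal_mult mult.assoc c_def)
          also have "W k powr (1 / s) * c (?R k) = (W k powr (1 / s) * ?R k powr (d * (1 / s))) * \<phi> (?R k)"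
            by (simp add: c_def)
          also have "W k powr (1 / s) * ?R k powr (d * (1 / s)) = r powr (d * (1 / s))"
            unfolding W_def by (rule powr_dyadic_weight[OF r])
          also have "r powr (d * (1 / s)) * \<phi> (?R k) \<le> r powr (d * (1 / s)) * (B * \<phi> r)"
            by (intro mult_left_mono \<phi>_le) simp
          then have "ennreal (r powr (d * (1 / s)) * \<phi> (?R k)) * F \<le> ennreal (B * c r) * F"
            by (intro mult_right_mono ennreal_leI) (simp_all add: c_def mult_ac)
          finally show "ennreal_pow (ennreal (W k) * h y (?R k)) (1 / s) \<le> ennreal (B * c r) * F" .
        qed simp
        also have "\<dots> = ennreal (c r) * (ennreal C' * F)"
          using B(1) \<phi>[OF r] by (simp add: C'_def c_def ennreal_mult mult_ac)
        finally show ?case .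
      qed
      then show ?thesis
        unfolding amalgam_norm_top[OF s0]
        by (intro esssup_I measurable_ennreal_pow measurable_ball_integral measurable_maximal g)
    qed
    then show ?thesis
      using norm_eq by (simp add: F_def)
  qed
  moreover have "0 < C'" using K B(1) by (simp add: C'_def)
  ultimately show ?thesis by blast
qed

section \<open>Both exponents infinite\<close>

text \<open>Needed to apply \<open>esssup_I\<close> to the outer essential supremum. The inner one
  exceeds c exactly when {u > c} meets the ball in positive measure, that is, when the ball integral
  of an indicator is positive, which is an open condition on y.\<close>

lemma measurable_esssup_ball:
  fixes u :: "'a::euclidean_space \<Rightarrow> ennreal"
  assumes u: "u \<in> borel_measurable lebesgue"
  shows "(\<lambda>y. esssup lebesgue (\<lambda>x. u x * indicator (ball y r) x)) \<in> borel_measurable lebesgue"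
proof (rule borel_measurable_lebesgue_openI)
  fix c :: ennreal
  have level: "{x. c < u x} \<in> sets lebesgue"
  proof -
    note u[measurable]
    have "{x \<in> space lebesgue. c < u x} \<in> sets lebesgue" by measurable
    then show ?thesis by simp
  qed
  have "c < esssup lebesgue (\<lambda>x. u x * indicator (ball y r) x) \<longleftrightarrow>
      0 < (\<integral>\<^sup>+x\<in>ball y r. indicator {x. c < u x} x \<partial>lebesgue)" for y
  proof -
    let ?v = "\<lambda>x. u x * indicator (ball y r) x"
    have v: "?v \<in> borel_measurable lebesgue" by (rule measurable_times_indicator_ball[OF u])
    have "(\<integral>\<^sup>+x\<in>ball y r. indicator {x. c < u x} x \<partial>lebesgue) =
        (\<integral>\<^sup>+x. indicator {x \<in> space lebesgue. c < ?v x} x \<partial>lebesgue)"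
      by (intro nn_integral_cong) (auto split: split_indicator)
    also have "\<dots> = emeasure lebesgue {x \<in> space lebesgue. c < ?v x}"
      by (rule nn_integral_indicator, rule borel_measurable_less[OF borel_measurable_const v])
    finally have eq: "(\<integral>\<^sup>+x\<in>ball y r. indicator {x. c < u x} x \<partial>lebesgue) =
        emeasure lebesgue {x \<in> space lebesgue. c < ?v x}" .
    show ?thesis
    proof
      assume "c < esssup lebesgue ?v"
      then show "0 < (\<integral>\<^sup>+x\<in>ball y r. indicator {x. c < u x} x \<partial>lebesgue)"
        unfolding eq by (rule esssup_pos_measure[OF v])
    next
      assume pos: "0 < (\<integral>\<^sup>+x\<in>ball y r. indicator {x. c < u x} x \<partial>lebesgue)"
      show "c < esssup lebesgue ?v"
      proof (rule ccontr)
        assume "\<not> c < esssup lebesgue ?v"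
        then have "esssup lebesgue ?v \<le> c" by simp
        then have "emeasure lebesgue {x \<in> space lebesgue. c < ?v x} \<le>
            emeasure lebesgue {x \<in> space lebesgue. esssup lebesgue ?v < ?v x}"
          by (intro emeasure_mono borel_measurable_less borel_measurable_const v) auto
        with pos show False
          unfolding eq esssup_zero_measure by simp
      qed
    qed
  qed
  then show "open {y. c < esssup lebesgue (\<lambda>x. u x * indicator (ball y r) x)}"
    using open_ball_integral_gt[of "indicator {x. c < u x}" 0 r] level
    by (simp add: borel_measurable_indicator)
qed

text \<open>For almost every center y the bound holds almost everywhere on B(y,r). Such good centers
  occur in every ball of radius r, since that ball is not null, so their balls cover the space. A
  countable Lindelof subcover then keeps the union of exceptional sets null.\<close>

lemma AE_le_of_amalgam_norm:
  fixes g :: "'a::euclidean_space \<Rightarrow> ennreal"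
  assumes "0 < r"
  shows "AE x in lebesgue. g x \<le> amalgam_norm r top top g"
proof -
  define E where "E = amalgam_norm r top top g"
  define G where "G = {y. AE x in lebesgue. g x * indicator (ball y r) x \<le> E}"
  have "AE y in lebesgue. esssup lebesgue (\<lambda>x. g x * indicator (ball y r) x) \<le> E"
    unfolding E_def amalgam_norm_def Lp_norm_def by (simp add: esssup_AE)
  then have "AE y in lebesgue. y \<in> G"
  proof eventually_elim
    case (elim y)
    have "AE x in lebesgue. g x * indicator (ball y r) x \<le> esssup lebesgue (\<lambda>x. g x * indicator (ball y r) x)"
      by (rule esssup_AE)
    then show ?case
      using elim unfolding G_def by (auto elim: eventually_mono order_trans)
  qed
  then obtain N where N: "{y \<in> space lebesgue. y \<notin> G} \<subseteq> N" "emeasure lebesgue N = 0" "N \<in> sets lebesgue"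
    by (rule AE_E)
  have "\<exists>y\<in>G. x \<in> ball y r" for x
  proof (rule ccontr)
    assume "\<not> ?thesis"
    then have "ball x r \<subseteq> N"
      using N(1) by (auto simp: dist_commute)
    then have "emeasure lebesgue (ball x r) \<le> emeasure lebesgue N"
      using N(3) by (rule emeasure_mono)
    then show False
      using N(2) emeasure_lebesgue_ball_neq(1)[OF assms, of x] by simp
  qed
  then have cover: "(\<Union>y\<in>G. ball y r) = UNIV" by auto
  obtain \<F> where \<F>: "\<F> \<subseteq> (\<lambda>y. ball y r) ` G" "countable \<F>" "\<Union>\<F> = \<Union>((\<lambda>y. ball y r) ` G)"
    by (rule Lindelof[of "(\<lambda>y. ball y r) ` G"]) auto
  obtain G' where G': "countable G'" "G' \<subseteq> G" "\<F> = (\<lambda>y. ball y r) ` G'"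
    using \<F>(1,2) countable_subset_image by metis
  have "AE x in lebesgue. \<forall>y\<in>G'. g x * indicator (ball y r) x \<le> E"
    using G' by (subst AE_ball_countable) (auto simp: G_def)
  then show ?thesis
    unfolding E_def[symmetric]
  proof eventually_elim
    case (elim x)
    obtain y where "y \<in> G'" "x \<in> ball y r"
      using \<F>(3) G'(3) cover by blast
    with elim show ?case by force
  qed
qed

lemma maximal_le_AE_bound:
  fixes g :: "'a::euclidean_space \<Rightarrow> ennreal"
  assumes "AE x in lebesgue. g x \<le> E"
  shows "maximal g x \<le> E"
  unfolding maximal_def
proof (rule SUP_least)
  fix t :: real assume "t \<in> {0<..}"
  then have t: "0 < t" by simp
  have "(\<integral>\<^sup>+y\<in>ball x t. g y \<partial>lebesgue) \<le> (\<integral>\<^sup>+y. E * indicator (ball x t) y \<partial>lebesgue)"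
    using assms by (intro nn_integral_mono_AE) (auto elim!: eventually_mono split: split_indicator)
  also have "\<dots> = E * emeasure lebesgue (ball x t)"
    by (rule nn_integral_cmult_indicator) simp
  finally show "(\<integral>\<^sup>+y\<in>ball x t. g y \<partial>lebesgue) / emeasure lebesgue (ball x t) \<le> E"
    by (simp only: divide_le_iff_ennreal[OF emeasure_lebesgue_ball_neq[OF t]])
qed

lemma fofana_maximal_top_top:
  fixes g :: "'a::euclidean_space \<Rightarrow> ennreal"
  assumes g: "g \<in> borel_measurable lebesgue"
  shows "fofana_norm top top \<phi> (maximal g) \<le> fofana_norm top top \<phi> g"
proof -
  have "amalgam_norm r top top (maximal g) \<le> amalgam_norm r top top g" if r: "0 < r" for r
  proof -
    define E where "E = amalgam_norm r top top g"
    have "maximal g x \<le> E" for x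
      unfolding E_def by (intro maximal_le_AE_bound AE_le_of_amalgam_norm r)
    then have "maximal g x * indicator (ball y r) x \<le> E" for x y
      by (simp split: split_indicator)
    then have "esssup lebesgue (\<lambda>x. maximal g x * indicator (ball y r) x) \<le> E" for y
      by (intro esssup_I measurable_times_indicator_ball measurable_maximal g) simp
    then have "esssup lebesgue (\<lambda>y. esssup lebesgue (\<lambda>x. maximal g x * indicator (ball y r) x)) \<le> E"
      by (intro esssup_I measurable_esssup_ball measurable_maximal g) simp
    then show ?thesis
      by (simp add: amalgam_norm_def Lp_norm_def E_def)
  qed
  then show ?thesis
    unfolding fofana_norm_def by (intro SUP_mono) (auto intro!: mult_left_mono bexI)
qed

section \<open>Combination of the cases of exponents\<close>

theorem theorem3p1:
  fixes q p :: ennreal and \<phi> :: "real \<Rightarrow> real"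
  assumes "1 < q" and "q \<le> p"
    and "\<phi> \<in> fofana_class CARD('n::finite) q p"
    and "q < \<infinity> \<Longrightarrow> \<exists>C>0. \<forall>r>0.
           (\<integral>\<^sup>+ t\<in>{r<..}. ennreal (\<phi> t powr enn2real q
               * t powr (CARD('n) * enn2real q * recip p - 1)) \<partial>lebesgue)
           \<le> ennreal (C * (\<phi> r powr enn2real q * r powr (CARD('n) * enn2real q * recip p)))"
  shows "\<exists>C'>0. \<forall>f \<in> (fofana_space q p \<phi> :: (real ^ 'n \<Rightarrow> complex) set).
           fofana_norm q p \<phi> (hl_maximal f)
           \<le> ennreal C' * fofana_norm q p \<phi> (\<lambda>x. ennreal (cmod (f x)))"
proof -
  have \<phi>: "\<And>t. 0 < t \<Longrightarrow> 0 < \<phi> t"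
    using assms(3) by (simp add: fofana_class_def)
  have "\<exists>B>0. \<forall>t u. 0 < t \<and> t \<le> u \<longrightarrow>
      u powr (CARD('n) * recip p) * \<phi> u \<le> B * (t powr (CARD('n) * recip p) * \<phi> t)"
    using assms(3) unfolding fofana_class_def by (elim CollectE conjE)
  then obtain B where B: "0 < B" "\<And>t u. 0 < t \<Longrightarrow> t \<le> u \<Longrightarrow>
      u powr (CARD('n) * recip p) * \<phi> u \<le> B * (t powr (CARD('n) * recip p) * \<phi> t)"
    by metis
  \<comment> \<open>The maximal operator sees f only through its absolute value, so the estimate is
    proved for extended nonnegative functions.\<close>
  have "\<exists>C'>0. \<forall>g :: real ^ 'n \<Rightarrow> ennreal. g \<in> borel_measurable lebesgue \<longrightarrow>
    fofana_norm q p \<phi> (maximal g) \<le> ennreal C' * fofana_norm q p \<phi> g"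
  proof (cases q)
    case top
    then have "p = top" using assms(2) by (simp add: top_unique)
    with top show ?thesis
      using fofana_maximal_top_top[where 'a = "real ^ 'n" and \<phi> = \<phi>] by (intro exI[of _ 1]) simp
  next
    case (real s)
    have s: "1 < s" using assms(1) real by simp
    show ?thesis
    proof (cases p)
      case top
      \<comment> \<open>Since \<open>recip top\<close> is 0, the powers of t and u in
        \<open>B\<close> equal 1.\<close>
      show ?thesis
        unfolding real(2) top using B top by (intro fofana_maximal_top[OF s \<phi> B(1)]) auto
    next
      case (real m)
      have m: "s \<le> m" using assms(2) \<open>q = ennreal s\<close> real s by simp
      then have p: "recip p = 1 / m" using real s by (simp add: recip_ennreal)
      obtain C where C: "0 < C" "\<And>r. 0 < r \<Longrightarrow>
          (\<integral>\<^sup>+t\<in>{r<..}. ennreal (\<phi> t powr s * t powr (CARD('n) * s / m - 1)) \<partial>lebesgue)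
          \<le> ennreal (C * (\<phi> r powr s * r powr (CARD('n) * s / m)))"
        using assms(4) \<open>q = ennreal s\<close> s p by auto
      show ?thesis
        unfolding real(2) \<open>q = ennreal s\<close>
        using B C p by (intro fofana_maximal_finite[OF s m \<phi> B(1) _ C(1)]) auto
    qed
  qed
  then show ?thesis
    unfolding fofana_space_def hl_maximal_eq by (elim ex_forward conj_forward) auto
qed

end
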